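(* Let $V$ be a $k$-vector space. There exists a connected Hopf algebra structure on the augmented free $NS$-algebra $k1\oplus\mathcal N(V)$ on $V$, as well as on the augmented free commutative $NS$-algebra on $V$ (in both cases with the associative product given by $\star$, extended so that $1$ is a unit).
   Context: Throughout, $k$ is a field of characteristic zero. An $NS$-algebra is a $k$-vector space with three bilinear operations $\prec,\succ,\bullet$ such that, with $\star:=\prec+\succ+\bullet$ (an associative operation), for all $x,y,z$: $(x\prec y)\prec z=x\prec(y\star z)$; $(x\succ y)\prec z=x\succ(y\prec z)$; $(x\star y)\succ z=x\succ(y\succ z)$; $(x\star y)\bullet z+(x\bullet y)\prec z=x\succ(y\bullet z)+x\bullet(y\star z)$. It is commutative if $x\prec y=y\succ x$ and $x\bullet y=y\bullet x$ for all $x,y$. Free (commutative) $NS$-algebras on $V$ are characterized by the usual universal property; the augmentation of an algebra $P$ is $P_+:=k1\oplus P$. A bialgebra $(H,\mu,\Delta,\eta,\kappa)$ (unital associative algebra, counital coassociative coalgebra, with $\Delta,\kappa$ morphisms of unital algebras) is connected if $H=\bigcup_r F_rH$, where $F_0H:=k1_H$ and $F_rH:=\{x\in H:\Delta(x)-1_H\otimes x-x\otimes1_H\in F_{r-1}H\otimes F_{r-1}H\}$. A connected bialgebra admits an antipode and is called a connected Hopf algebra. *)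

theory Defs
  imports Complex_Main "HOL-Library.Poly_Mapping" "HOL-Library.Product_Plus"
begin

section \<open>NS-algebras\<close>

definition bilinear_op_on ::
    "('k::field \<Rightarrow> 'a::ab_group_add \<Rightarrow> 'a) \<Rightarrow> 'a set \<Rightarrow> ('a \<Rightarrow> 'a \<Rightarrow> 'a) \<Rightarrow> bool"
  where "bilinear_op_on s A m \<longleftrightarrow>
    (\<forall>x\<in>A. \<forall>y\<in>A. m x y \<in> A \<and> (\<forall>c. m (s c x) y = s c (m x y) \<and> m x (s c y) = s c (m x y))) \<and>
    (\<forall>x\<in>A. \<forall>y\<in>A. \<forall>z\<in>A. m (x + y) z = m x z + m y z \<and> m z (x + y) = m z x + m z y)"

definition ns_star ::
    "('a::ab_group_add \<Rightarrow> 'a \<Rightarrow> 'a) \<Rightarrow> ('a \<Rightarrow> 'a \<Rightarrow> 'a) \<Rightarrow> ('a \<Rightarrow> 'a \<Rightarrow> 'a) \<Rightarrow> 'a \<Rightarrow> 'a \<Rightarrow> 'a"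
  where "ns_star prec succ bul x y = prec x y + succ x y + bul x y"

text \<open>The underlying vector space is a subspace \<open>A\<close> of the type \<open>'a\<close>; the operations are
  unconstrained outside \<open>A\<close>.  Associativity of \<open>\<star>\<close> is a consequence (lemma \<open>star_assoc\<close>).\<close>

locale ns_algebra = vector_space scale
  for scale :: "'k::field \<Rightarrow> 'a::ab_group_add \<Rightarrow> 'a" +
  fixes A :: "'a set"
    and prec succ bul :: "'a \<Rightarrow> 'a \<Rightarrow> 'a"
  assumes subspace_carrier: "subspace A"
    and bilinear_prec: "bilinear_op_on scale A prec"
    and bilinear_succ: "bilinear_op_on scale A succ"
    and bilinear_bul: "bilinear_op_on scale A bul"
    and ns1: "\<lbrakk>x \<in> A; y \<in> A; z \<in> A\<rbrakk> \<Longrightarrow>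
      prec (prec x y) z = prec x (ns_star prec succ bul y z)"
    and ns2: "\<lbrakk>x \<in> A; y \<in> A; z \<in> A\<rbrakk> \<Longrightarrow>
      prec (succ x y) z = succ x (prec y z)"
    and ns3: "\<lbrakk>x \<in> A; y \<in> A; z \<in> A\<rbrakk> \<Longrightarrow>
      succ (ns_star prec succ bul x y) z = succ x (succ y z)"
    and ns4: "\<lbrakk>x \<in> A; y \<in> A; z \<in> A\<rbrakk> \<Longrightarrow>
      bul (ns_star prec succ bul x y) z + prec (bul x y) z =
      succ x (bul y z) + bul x (ns_star prec succ bul y z)"

locale comm_ns_algebra = ns_algebra +
  assumes prec_succ_comm: "\<lbrakk>x \<in> A; y \<in> A\<rbrakk> \<Longrightarrow> prec x y = succ y x"
    and bul_comm: "\<lbrakk>x \<in> A; y \<in> A\<rbrakk> \<Longrightarrow> bul x y = bul y x"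

lemma (in ns_algebra) star_assoc:
  assumes "x \<in> A" "y \<in> A" "z \<in> A"
  defines "star \<equiv> ns_star prec succ bul"
  shows "star (star x y) z = star x (star y z)"
proof -
  note b = bilinear_prec bilinear_succ bilinear_bul
  have cl: "prec u v \<in> A" "succ u v \<in> A" "bul u v \<in> A" if "u \<in> A" "v \<in> A" for u v
    using b that unfolding bilinear_op_on_def by blast+
  have l: "prec (u + v + t) w = prec u w + prec v w + prec t w"
    if "u \<in> A" "v \<in> A" "t \<in> A" "w \<in> A" for u v t w
    using b(1) that subspace_add[OF subspace_carrier] unfolding bilinear_op_on_def by metis
  have r: "succ w (u + v + t) = succ w u + succ w v + succ w t"
    if "u \<in> A" "v \<in> A" "t \<in> A" "w \<in> A" for u v t w
    using b(2) that subspace_add[OF subspace_carrier] unfolding bilinear_op_on_def by metis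
  have "star (star x y) z = prec (prec x y) z + prec (succ x y) z + prec (bul x y) z
      + succ (star x y) z + bul (star x y) z"
    using l[of "prec x y" "succ x y" "bul x y" z] assms(1-3) cl
    unfolding star_def ns_star_def by simp
  also have "\<dots> = prec x (star y z) + succ x (prec y z) + succ x (succ y z)
      + (bul (star x y) z + prec (bul x y) z)"
    using ns1[OF assms(1-3)] ns2[OF assms(1-3)] ns3[OF assms(1-3)]
    by (simp add: star_def algebra_simps)
  also have "\<dots> = prec x (star y z) + succ x (prec y z) + succ x (succ y z)
      + (succ x (bul y z) + bul x (star y z))"
    using ns4[OF assms(1-3)] by (simp add: star_def)
  also have "\<dots> = star x (star y z)"
    using r[of "prec y z" "succ y z" "bul y z" x] assms(1-3) cl
    unfolding star_def ns_star_def by (simp add: add.assoc)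
  finally show ?thesis .
qed

section \<open>Free NS-algebras\<close>

definition ns_hom_into ::
    "('k::field \<Rightarrow> 'a::ab_group_add \<Rightarrow> 'a) \<Rightarrow> ('a \<Rightarrow> 'a \<Rightarrow> 'a) \<Rightarrow> ('a \<Rightarrow> 'a \<Rightarrow> 'a) \<Rightarrow> ('a \<Rightarrow> 'a \<Rightarrow> 'a) \<Rightarrow>
     ('k \<Rightarrow> 'b::ab_group_add \<Rightarrow> 'b) \<Rightarrow> 'b set \<Rightarrow> ('b \<Rightarrow> 'b \<Rightarrow> 'b) \<Rightarrow> ('b \<Rightarrow> 'b \<Rightarrow> 'b) \<Rightarrow> ('b \<Rightarrow> 'b \<Rightarrow> 'b) \<Rightarrow>
     ('a \<Rightarrow> 'b) \<Rightarrow> bool"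
  where "ns_hom_into s prec succ bul t B prec' succ' bul' \<phi> \<longleftrightarrow>
    Vector_Spaces.linear s t \<phi> \<and> range \<phi> \<subseteq> B \<and>
    (\<forall>x y. \<phi> (prec x y) = prec' (\<phi> x) (\<phi> y)) \<and>
    (\<forall>x y. \<phi> (succ x y) = succ' (\<phi> x) (\<phi> y)) \<and>
    (\<forall>x y. \<phi> (bul x y) = bul' (\<phi> x) (\<phi> y))"

text \<open>The space \<open>'x \<Rightarrow>\<^sub>0 'k\<close> is the vector space with basis \<open>'x\<close>.\<close>

definition fscale :: "'k::field \<Rightarrow> ('x \<Rightarrow>\<^sub>0 'k) \<Rightarrow> ('x \<Rightarrow>\<^sub>0 'k)"
  where "fscale c p = Poly_Mapping.map (\<lambda>a. c * a) p"

text \<open>Universal property of \<open>\<iota> : V \<rightarrow> N\<close> (\<open>V\<close> and \<open>N\<close> being all of \<open>'v\<close> and \<open>'a\<close>).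
  HOL cannot quantify over the types carrying the target algebras, so the targets range over
  all NS-algebras whose underlying space is a subspace of the space with basis
  \<open>('v + 'a) list\<close>.  Up to isomorphism these comprise all NS-algebras generated by an image
  of \<open>V\<close>, as well as \<open>N\<close> and its subalgebras; hence the property for these targets already gives
  that \<open>N\<close> is generated by \<open>\<iota>(V)\<close> and, with it, the universal property for arbitrary targets
  (lemmas \<open>free_ns_algebra_universal\<close> and \<open>free_comm_ns_algebra_universal\<close>).\<close>

definition free_ns_algebra ::
    "('k::field \<Rightarrow> 'v::ab_group_add \<Rightarrow> 'v) \<Rightarrow> ('v \<Rightarrow> 'a::ab_group_add) \<Rightarrow> ('k \<Rightarrow> 'a \<Rightarrow> 'a) \<Rightarrow>
     ('a \<Rightarrow> 'a \<Rightarrow> 'a) \<Rightarrow> ('a \<Rightarrow> 'a \<Rightarrow> 'a) \<Rightarrow> ('a \<Rightarrow> 'a \<Rightarrow> 'a) \<Rightarrow> bool"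
  where "free_ns_algebra sV \<iota> sN prec succ bul \<longleftrightarrow>
    ns_algebra sN UNIV prec succ bul \<and> Vector_Spaces.linear sV sN \<iota> \<and>
    (\<forall>(B :: (('v + 'a) list \<Rightarrow>\<^sub>0 'k) set) prec' succ' bul' f.
      ns_algebra fscale B prec' succ' bul' \<and> Vector_Spaces.linear sV fscale f \<and> range f \<subseteq> B \<longrightarrow>
      (\<exists>!\<phi>. ns_hom_into sN prec succ bul fscale B prec' succ' bul' \<phi> \<and> \<phi> \<circ> \<iota> = f))"

definition free_comm_ns_algebra ::
    "('k::field \<Rightarrow> 'v::ab_group_add \<Rightarrow> 'v) \<Rightarrow> ('v \<Rightarrow> 'a::ab_group_add) \<Rightarrow> ('k \<Rightarrow> 'a \<Rightarrow> 'a) \<Rightarrow>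
     ('a \<Rightarrow> 'a \<Rightarrow> 'a) \<Rightarrow> ('a \<Rightarrow> 'a \<Rightarrow> 'a) \<Rightarrow> ('a \<Rightarrow> 'a \<Rightarrow> 'a) \<Rightarrow> bool"
  where "free_comm_ns_algebra sV \<iota> sN prec succ bul \<longleftrightarrow>
    comm_ns_algebra sN UNIV prec succ bul \<and> Vector_Spaces.linear sV sN \<iota> \<and>
    (\<forall>(B :: (('v + 'a) list \<Rightarrow>\<^sub>0 'k) set) prec' succ' bul' f.
      comm_ns_algebra fscale B prec' succ' bul' \<and> Vector_Spaces.linear sV fscale f \<and> range f \<subseteq> B \<longrightarrow>
      (\<exists>!\<phi>. ns_hom_into sN prec succ bul fscale B prec' succ' bul' \<phi> \<and> \<phi> \<circ> \<iota> = f))"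

text \<open>The flag \<open>c\<close> treats the plain and the commutative case at once.  Existence: the subalgebra
  \<open>W\<close> of \<open>C\<close> generated by \<open>f(V)\<close> is spanned by evaluations of trees with leaves in \<open>V\<close>, hence
  embeds into the space with basis \<open>('v + 'a) list\<close>.  Uniqueness: by the property for the targets
  \<open>N\<close> and \<open>E \<subseteq> N\<close>, an equalizer \<open>E\<close> containing \<open>\<iota>(V)\<close> is all of \<open>N\<close>.\<close>

definition ns_algebra_if_comm ::
    "bool \<Rightarrow> ('k::field \<Rightarrow> 'a::ab_group_add \<Rightarrow> 'a) \<Rightarrow> 'a set \<Rightarrow>
     ('a \<Rightarrow> 'a \<Rightarrow> 'a) \<Rightarrow> ('a \<Rightarrow> 'a \<Rightarrow> 'a) \<Rightarrow> ('a \<Rightarrow> 'a \<Rightarrow> 'a) \<Rightarrow> bool"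
  where "ns_algebra_if_comm c s A p q b \<longleftrightarrow>
    ns_algebra s A p q b \<and> (c \<longrightarrow> comm_ns_algebra s A p q b)"

lemma ns_algebra_if_comm_iff:
  "ns_algebra_if_comm c s A p q b \<longleftrightarrow> vector_space s \<and> module.subspace s A \<and>
    bilinear_op_on s A p \<and> bilinear_op_on s A q \<and> bilinear_op_on s A b \<and>
    (\<forall>x\<in>A. \<forall>y\<in>A. \<forall>z\<in>A. p (p x y) z = p x (ns_star p q b y z) \<and>
       p (q x y) z = q x (p y z) \<and> q (ns_star p q b x y) z = q x (q y z) \<and>
       b (ns_star p q b x y) z + p (b x y) z = q x (b y z) + b x (ns_star p q b y z)) \<and>
    (c \<longrightarrow> (\<forall>x\<in>A. \<forall>y\<in>A. p x y = q y x \<and> b x y = b y x))"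
  unfolding ns_algebra_if_comm_def comm_ns_algebra_def comm_ns_algebra_axioms_def
    ns_algebra_def ns_algebra_axioms_def by (cases c) auto

lemma ns_algebra_if_comm_restrict:
  assumes "ns_algebra_if_comm c s A p q b" "module.subspace s W" "W \<subseteq> A"
    "\<And>x y. x \<in> W \<Longrightarrow> y \<in> W \<Longrightarrow> p x y \<in> W \<and> q x y \<in> W \<and> b x y \<in> W"
  shows "ns_algebra_if_comm c s W p q b"
proof -
  have "bilinear_op_on s W m" if "bilinear_op_on s A m" "\<And>x y. x \<in> W \<Longrightarrow> y \<in> W \<Longrightarrow> m x y \<in> W" for m
    using that assms(3) unfolding bilinear_op_on_def by blast
  then show ?thesis
    using assms unfolding ns_algebra_if_comm_iff by (simp add: subset_iff)
qed

lemma ns_algebra_if_comm_transport: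
  assumes A: "ns_algebra_if_comm c s A p q b"
    and g: "Vector_Spaces.linear s t g" and g': "Vector_Spaces.linear t s g'"
    and inv: "\<And>v. v \<in> A \<Longrightarrow> g' (g v) = v"
  shows "ns_algebra_if_comm c t (g ` A) (\<lambda>x y. g (p (g' x) (g' y)))
    (\<lambda>x y. g (q (g' x) (g' y))) (\<lambda>x y. g (b (g' x) (g' y)))"
proof -
  interpret g: Vector_Spaces.linear s t g by (rule g)
  interpret g': Vector_Spaces.linear t s g' by (rule g')
  have sub: "g.vs1.subspace A" and
    bil: "bilinear_op_on s A p" "bilinear_op_on s A q" "bilinear_op_on s A b"
    using A unfolding ns_algebra_if_comm_iff by auto
  have bil': "bilinear_op_on t (g ` A) (\<lambda>x y. g (m (g' x) (g' y)))"
    if m: "bilinear_op_on s A m" for m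
    using m sub unfolding bilinear_op_on_def
    by (auto simp: inv g'.add g'.scale g.add[symmetric] g.scale[symmetric])
  have cl: "p x y \<in> A" "q x y \<in> A" "b x y \<in> A" if "x \<in> A" "y \<in> A" for x y
    using bil that unfolding bilinear_op_on_def by blast+
  have star: "ns_star (\<lambda>x y. g (p (g' x) (g' y))) (\<lambda>x y. g (q (g' x) (g' y)))
      (\<lambda>x y. g (b (g' x) (g' y))) (g x) (g y) = g (ns_star p q b x y)"
    if "x \<in> A" "y \<in> A" for x y
    using that by (simp add: ns_star_def inv g.add)
  have starc: "ns_star p q b x y \<in> A" if "x \<in> A" "y \<in> A" for x y
    unfolding ns_star_def using that by (intro g.vs1.subspace_add[OF sub] cl)
  show ?thesis
    unfolding ns_algebra_if_comm_iff
  proof (intro conjI bil' bil ballI impI)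
    show "vector_space t" by (rule g.vs2.vector_space_axioms)
    show "g.vs2.subspace (g ` A)" using sub by (rule g.subspace_image)
  qed (use A in \<open>auto simp: ns_algebra_if_comm_iff star starc cl inv g.add[symmetric]\<close>)
qed

datatype 'v ns_tree = Leaf 'v | Prec "'v ns_tree" "'v ns_tree" | Succ "'v ns_tree" "'v ns_tree"
  | Bul "'v ns_tree" "'v ns_tree"

primrec ns_tree_code :: "'v ns_tree \<Rightarrow> ('v::zero + 'a::zero) list" where
  "ns_tree_code (Leaf v) = [Inl 0, Inl v]"
| "ns_tree_code (Prec t u) = [Inl 0, Inr 0] @ ns_tree_code t @ ns_tree_code u"
| "ns_tree_code (Succ t u) = [Inr 0, Inl 0] @ ns_tree_code t @ ns_tree_code u"
| "ns_tree_code (Bul t u) = [Inr 0, Inr 0] @ ns_tree_code t @ ns_tree_code u"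

lemma ns_tree_code_append:
  "ns_tree_code t @ xs = ns_tree_code t' @ ys \<Longrightarrow> t = t' \<and> xs = ys"
proof (induction t arbitrary: t' xs ys)
  case (Leaf v) then show ?case by (cases t') auto
next
  case (Prec t u)
  from Prec.prems obtain a b where ab: "t' = Prec a b" by (cases t') auto
  have eq: "ns_tree_code t @ (ns_tree_code u @ xs) = ns_tree_code a @ (ns_tree_code b @ ys)"
    using Prec.prems unfolding ab by simp
  show ?case using Prec.IH(1)[OF eq] Prec.IH(2)[of xs b ys] ab by simp
next
  case (Succ t u)
  from Succ.prems obtain a b where ab: "t' = Succ a b" by (cases t') auto
  have eq: "ns_tree_code t @ (ns_tree_code u @ xs) = ns_tree_code a @ (ns_tree_code b @ ys)"
    using Succ.prems unfolding ab by simp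
  show ?case using Succ.IH(1)[OF eq] Succ.IH(2)[of xs b ys] ab by simp
next
  case (Bul t u)
  from Bul.prems obtain a b where ab: "t' = Bul a b" by (cases t') auto
  have eq: "ns_tree_code t @ (ns_tree_code u @ xs) = ns_tree_code a @ (ns_tree_code b @ ys)"
    using Bul.prems unfolding ab by simp
  show ?case using Bul.IH(1)[OF eq] Bul.IH(2)[of xs b ys] ab by simp
qed

lemma inj_ns_tree_code: "inj ns_tree_code"
  using ns_tree_code_append[of _ "[]" _ "[]"] by (auto intro: injI)

primrec ns_tree_eval ::
  "('v \<Rightarrow> 'c) \<Rightarrow> ('c \<Rightarrow> 'c \<Rightarrow> 'c) \<Rightarrow> ('c \<Rightarrow> 'c \<Rightarrow> 'c) \<Rightarrow> ('c \<Rightarrow> 'c \<Rightarrow> 'c) \<Rightarrow> 'v ns_tree \<Rightarrow> 'c" where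
  "ns_tree_eval f p q b (Leaf v) = f v"
| "ns_tree_eval f p q b (Prec t u) = p (ns_tree_eval f p q b t) (ns_tree_eval f p q b u)"
| "ns_tree_eval f p q b (Succ t u) = q (ns_tree_eval f p q b t) (ns_tree_eval f p q b u)"
| "ns_tree_eval f p q b (Bul t u) = b (ns_tree_eval f p q b t) (ns_tree_eval f p q b u)"

lemma lookup_fscale [simp]: "Poly_Mapping.lookup (fscale c p) x = c * Poly_Mapping.lookup p x"
  by (simp add: fscale_def Poly_Mapping.map.rep_eq when_def)

lemma vector_space_fscale: "vector_space fscale"
  by unfold_locales (auto intro!: poly_mapping_eqI simp: lookup_add algebra_simps)

lemma independent_single:
  "\<not> module.dependent fscale (range (\<lambda>x. Poly_Mapping.single x (1::'k::field)))"
proof -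
  interpret vector_space "fscale :: 'k \<Rightarrow> ('a \<Rightarrow>\<^sub>0 'k) \<Rightarrow> _" by (rule vector_space_fscale)
  have "u v = 0" if t: "finite t" "t \<subseteq> range (\<lambda>x. Poly_Mapping.single x (1::'k))"
    and 0: "(\<Sum>w\<in>t. fscale (u w) w) = 0" and v: "v \<in> t" for t u v
  proof -
    obtain x where x: "v = Poly_Mapping.single x 1" using t v by auto
    have w: "Poly_Mapping.lookup w x = (if w = v then 1 else 0)" if "w \<in> t" for w
    proof -
      obtain y where y: "w = Poly_Mapping.single y 1" using t \<open>w \<in> t\<close> by blast
      have "w = v \<longleftrightarrow> y = x"
        unfolding x y by (metis lookup_single_eq lookup_single_not_eq one_neq_zero)
      then show ?thesis unfolding y by (auto simp: lookup_single when_def)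
    qed
    have "0 = Poly_Mapping.lookup (\<Sum>w\<in>t. fscale (u w) w) x" using 0 by simp
    also have "\<dots> = (\<Sum>w\<in>t. u w * Poly_Mapping.lookup w x)" by (simp add: lookup_sum)
    also have "\<dots> = (\<Sum>w\<in>t. if w = v then u w else 0)" using w by (intro sum.cong) auto
    also have "\<dots> = u v" using t v by simp
    finally show ?thesis by simp
  qed
  then show ?thesis unfolding independent_explicit_module by blast
qed

lemma embedding_exists:
  fixes s :: "'k::field \<Rightarrow> 'a::ab_group_add \<Rightarrow> 'a" and j :: "'a \<Rightarrow> 'x"
  assumes "vector_space s" and j: "inj_on j S"
  obtains g g' where "Vector_Spaces.linear s (fscale :: 'k \<Rightarrow> ('x \<Rightarrow>\<^sub>0 'k) \<Rightarrow> _) g"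
    "Vector_Spaces.linear fscale s g'" "\<And>v. v \<in> module.span s S \<Longrightarrow> g' (g v) = v"
proof -
  interpret s: vector_space s by fact
  interpret f: vector_space "fscale :: 'k \<Rightarrow> ('x \<Rightarrow>\<^sub>0 'k) \<Rightarrow> _" by (rule vector_space_fscale)
  interpret vector_space_pair s "fscale :: 'k \<Rightarrow> ('x \<Rightarrow>\<^sub>0 'k) \<Rightarrow> _" ..
  obtain B where B: "B \<subseteq> S" "s.independent B" "S \<subseteq> s.span B"
    using s.maximal_independent_subset[of S] by blast
  obtain g where g: "Vector_Spaces.linear s (fscale :: 'k \<Rightarrow> ('x \<Rightarrow>\<^sub>0 'k) \<Rightarrow> _) g"
    and gB: "\<And>b. b \<in> B \<Longrightarrow> g b = Poly_Mapping.single (j b) 1"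
    using linear_independent_extend[OF B(2), of "\<lambda>b. Poly_Mapping.single (j b) 1"] by blast
  have "g ` B \<subseteq> range (\<lambda>x. Poly_Mapping.single x 1)" using gB by auto
  then have "f.independent (g ` B)" using f.independent_mono[OF independent_single] by blast
  moreover have "inj_on g B"
  proof (rule inj_onI)
    fix x y assume xy: "x \<in> B" "y \<in> B" "g x = g y"
    then have "Poly_Mapping.lookup (Poly_Mapping.single (j x) (1::'k)) (j x) =
        Poly_Mapping.lookup (Poly_Mapping.single (j y) (1::'k)) (j x)" by (simp add: gB)
    then have "j x = j y" by (auto simp: lookup_single when_def split: if_splits)
    then show "x = y" using xy B(1) j by (meson inj_onD subsetD)
  qed
  ultimately have inj: "inj_on g (s.span B)"
    using linear_inj_on_span_iff_independent_image[OF g] by blast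
  have "s.span S = s.span B"
    using B by (metis s.span_mono s.span_span subset_antisym)
  with inj obtain g' where "Vector_Spaces.linear fscale s g'" "\<And>v. v \<in> s.span S \<Longrightarrow> g' (g v) = v"
    using linear_exists_left_inverse_on[OF g s.subspace_span[of B]] by metis
  with g show thesis using that by blast
qed

lemma ns_hom_into_compose:
  assumes "ns_hom_into s p q b t B p' q' b' \<phi>" "Vector_Spaces.linear t r h" "h ` B \<subseteq> C"
    "\<And>x y. x \<in> B \<Longrightarrow> y \<in> B \<Longrightarrow> h (p' x y) = p'' (h x) (h y)"
    "\<And>x y. x \<in> B \<Longrightarrow> y \<in> B \<Longrightarrow> h (q' x y) = q'' (h x) (h y)"
    "\<And>x y. x \<in> B \<Longrightarrow> y \<in> B \<Longrightarrow> h (b' x y) = b'' (h x) (h y)"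
  shows "ns_hom_into s p q b r C p'' q'' b'' (h \<circ> \<phi>)"
proof -
  have "range \<phi> \<subseteq> B" using assms(1) unfolding ns_hom_into_def by blast
  then have "\<phi> x \<in> B" for x by auto
  then show ?thesis
    using assms Vector_Spaces.linear_compose[of s t \<phi> r h] unfolding ns_hom_into_def by auto
qed

lemma free_universal_aux:
  fixes sV :: "'k::field \<Rightarrow> 'v::ab_group_add \<Rightarrow> 'v" and \<iota> :: "'v \<Rightarrow> 'a::ab_group_add"
    and t :: "'k \<Rightarrow> 'c::ab_group_add \<Rightarrow> 'c"
  assumes N: "ns_algebra_if_comm c sN UNIV p q b" and \<iota>: "Vector_Spaces.linear sV sN \<iota>"
    and U: "\<And>(B :: (('v + 'a) list \<Rightarrow>\<^sub>0 'k) set) p' q' b' f.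
      ns_algebra_if_comm c fscale B p' q' b' \<Longrightarrow> Vector_Spaces.linear sV fscale f \<Longrightarrow> range f \<subseteq> B \<Longrightarrow>
      \<exists>!\<phi>. ns_hom_into sN p q b fscale B p' q' b' \<phi> \<and> \<phi> \<circ> \<iota> = f"
    and C: "ns_algebra_if_comm c t C p' q' b'"
    and f: "Vector_Spaces.linear sV t f" "range f \<subseteq> C"
  shows "\<exists>!\<phi>. ns_hom_into sN p q b t C p' q' b' \<phi> \<and> \<phi> \<circ> \<iota> = f"
proof (rule ex_ex1I)
  interpret t: vector_space t using C unfolding ns_algebra_if_comm_iff by blast
  interpret \<iota>: Vector_Spaces.linear sV sN \<iota> by (rule \<iota>)
  let ?F = "fscale :: 'k \<Rightarrow> (('v + 'a) list \<Rightarrow>\<^sub>0 'k) \<Rightarrow> _"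
  have subC: "t.subspace C" and bilC: "bilinear_op_on t C p'" "bilinear_op_on t C q'" "bilinear_op_on t C b'"
    using C unfolding ns_algebra_if_comm_iff by auto
  define ev where "ev = ns_tree_eval f p' q' b'"
  define W where "W = t.span (range ev)"
  have evC: "ev x \<in> C" for x
    unfolding ev_def using f(2) bilC by (induction x) (auto simp: bilinear_op_on_def)
  then have WC: "W \<subseteq> C" unfolding W_def by (intro t.span_minimal[OF _ subC]) auto
  have Wcl: "m x y \<in> W" if m: "bilinear_op_on t C m" and node: "\<And>x y. m (ev x) (ev y) \<in> range ev"
    and x: "x \<in> W" and y: "y \<in> W" for m x y
  proof -
    have 1: "m (ev u) y \<in> W \<and> y \<in> C" for u
      using y unfolding W_def
    proof (induction rule: t.span_induct_alt)
      case base
      have "m (ev u) (t 0 0) = t 0 (m (ev u) 0)"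
        using m evC t.subspace_0[OF subC] unfolding bilinear_op_on_def by blast
      then show ?case using t.span_zero t.subspace_0[OF subC] by simp
    next
      case (step a z w)
      obtain r where z: "z = ev r" using step(1) by blast
      have tz: "t a z \<in> C" "z \<in> C" using evC subC t.subspace_scale z by blast+
      have "m (ev u) (t a z + w) = t a (m (ev u) z) + m (ev u) w"
        using m evC step(2) tz unfolding bilinear_op_on_def by metis
      then show ?case
        using step(2) tz node[of u r] z t.subspace_add[OF subC]
        by (auto intro!: t.span_add t.span_scale intro: t.span_base)
    qed
    then have yC: "y \<in> C" and 1: "\<And>u. m (ev u) y \<in> W" by auto
    have "m x y \<in> W \<and> x \<in> C"
      using x unfolding W_def
    proof (induction rule: t.span_induct_alt)
      case base
      have "m (t 0 0) y = t 0 (m 0 y)"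
        using m yC t.subspace_0[OF subC] unfolding bilinear_op_on_def by blast
      then show ?case using t.span_zero t.subspace_0[OF subC] by simp
    next
      case (step a z w)
      obtain r where z: "z = ev r" using step(1) by blast
      have tz: "t a z \<in> C" "z \<in> C" using evC subC t.subspace_scale z by blast+
      have "m (t a z + w) y = t a (m z y) + m w y"
        using m yC step(2) tz unfolding bilinear_op_on_def by metis
      then show ?case
        using step(2) tz 1[of r] z t.subspace_add[OF subC]
        unfolding W_def by (auto intro!: t.span_add t.span_scale)
    qed
    then show ?thesis by blast
  qed
  have nodes: "p' (ev x) (ev y) \<in> range ev" "q' (ev x) (ev y) \<in> range ev" "b' (ev x) (ev y) \<in> range ev" for x y
    by (metis ev_def ns_tree_eval.simps rangeI)+
  have W: "ns_algebra_if_comm c t W p' q' b'"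
    using Wcl[OF bilC(1) nodes(1)] Wcl[OF bilC(2) nodes(2)] Wcl[OF bilC(3) nodes(3)] WC
    by (intro ns_algebra_if_comm_restrict[OF C]) (auto simp: W_def)
  have fW: "f v \<in> W" for v
    unfolding W_def by (rule t.span_base) (metis ev_def ns_tree_eval.simps(1) rangeI)
  define j :: "'c \<Rightarrow> ('v + 'a) list" where "j = ns_tree_code \<circ> inv_into UNIV ev"
  have "inj_on j (range ev)"
    unfolding j_def by (intro comp_inj_on inj_on_inv_into order_refl inj_on_subset[OF inj_ns_tree_code subset_UNIV])
  then obtain g g' where g: "Vector_Spaces.linear t ?F g" and g': "Vector_Spaces.linear ?F t g'"
    and gg': "\<And>v. v \<in> W \<Longrightarrow> g' (g v) = v"
    using embedding_exists[OF t.vector_space_axioms, of j "range ev"] unfolding W_def by blast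
  have "range (g \<circ> f) \<subseteq> g ` W" using fW by auto
  from U[OF ns_algebra_if_comm_transport[OF W g g' gg'] Vector_Spaces.linear_compose[OF f(1) g] this]
  obtain \<phi> where \<phi>: "ns_hom_into sN p q b ?F (g ` W) (\<lambda>x y. g (p' (g' x) (g' y)))
      (\<lambda>x y. g (q' (g' x) (g' y))) (\<lambda>x y. g (b' (g' x) (g' y))) \<phi>" and \<phi>\<iota>: "\<phi> \<circ> \<iota> = g \<circ> f"
    by blast
  have Wcl': "p' x y \<in> W" "q' x y \<in> W" "b' x y \<in> W" if "x \<in> W" "y \<in> W" for x y
    using W that unfolding ns_algebra_if_comm_iff bilinear_op_on_def by blast+
  have "ns_hom_into sN p q b t C p' q' b' (g' \<circ> \<phi>)"
    using WC by (intro ns_hom_into_compose[OF \<phi> g']) (auto simp: gg' Wcl')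
  moreover have "(g' \<circ> \<phi>) \<circ> \<iota> = f"
    unfolding o_assoc[symmetric] \<phi>\<iota> using gg' fW by (auto simp: fun_eq_iff)
  ultimately show "\<exists>\<phi>. ns_hom_into sN p q b t C p' q' b' \<phi> \<and> \<phi> \<circ> \<iota> = f" by blast
next
  fix \<phi>1 \<phi>2
  assume "ns_hom_into sN p q b t C p' q' b' \<phi>1 \<and> \<phi>1 \<circ> \<iota> = f"
    and "ns_hom_into sN p q b t C p' q' b' \<phi>2 \<and> \<phi>2 \<circ> \<iota> = f"
  then have h1: "ns_hom_into sN p q b t C p' q' b' \<phi>1" "\<phi>1 \<circ> \<iota> = f"
    and h2: "ns_hom_into sN p q b t C p' q' b' \<phi>2" "\<phi>2 \<circ> \<iota> = f" by auto
  let ?F = "fscale :: 'k \<Rightarrow> (('v + 'a) list \<Rightarrow>\<^sub>0 'k) \<Rightarrow> _"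
  interpret n: vector_space sN using N unfolding ns_algebra_if_comm_iff by blast
  interpret a: Vector_Spaces.linear sN t \<phi>1 using h1 unfolding ns_hom_into_def by blast
  interpret b: Vector_Spaces.linear sN t \<phi>2 using h2 unfolding ns_hom_into_def by blast
  define E where "E = {x. \<phi>1 x = \<phi>2 x}"
  have "n.subspace E"
    unfolding E_def by (rule n.subspaceI) (auto simp: a.add b.add a.scale b.scale)
  then have E: "ns_algebra_if_comm c sN E p q b"
    using h1 h2 by (intro ns_algebra_if_comm_restrict[OF N]) (auto simp: E_def ns_hom_into_def)
  have \<iota>E: "\<iota> v \<in> E" for v
    using h1(2) h2(2) unfolding E_def by (auto simp: fun_eq_iff)
  define j :: "'a \<Rightarrow> ('v + 'a) list" where "j x = [Inr x]" for x
  have "inj_on j UNIV" by (auto simp: j_def inj_on_def)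
  then obtain h h' where h: "Vector_Spaces.linear sN ?F h" and h': "Vector_Spaces.linear ?F sN h'"
    and hh: "\<And>v. h' (h v) = v"
    using embedding_exists[OF n.vector_space_axioms, of j UNIV] n.span_UNIV by (metis UNIV_I)
  let ?p = "\<lambda>x y. h (p (h' x) (h' y))" and ?q = "\<lambda>x y. h (q (h' x) (h' y))"
    and ?b = "\<lambda>x y. h (b (h' x) (h' y))"
  note h\<iota> = Vector_Spaces.linear_compose[OF \<iota> h]
  have "range (h \<circ> \<iota>) \<subseteq> h ` E" using \<iota>E by auto
  from U[OF ns_algebra_if_comm_transport[OF E h h' hh] h\<iota> this]
  obtain r where r: "ns_hom_into sN p q b ?F (h ` E) ?p ?q ?b r" "r \<circ> \<iota> = h \<circ> \<iota>" by blast
  then have r': "ns_hom_into sN p q b ?F (range h) ?p ?q ?b r"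
    unfolding ns_hom_into_def by blast
  have hh': "ns_hom_into sN p q b ?F (range h) ?p ?q ?b h"
    using h unfolding ns_hom_into_def by (simp add: hh)
  have "range (h \<circ> \<iota>) \<subseteq> range h" by auto
  from U[OF ns_algebra_if_comm_transport[OF N h h' hh] h\<iota> this] r r' hh' have "r = h" by blast
  then have "h x \<in> h ` E" for x using r(1) unfolding ns_hom_into_def by blast
  then have "x \<in> E" for x using hh by (metis imageE)
  then show "\<phi>1 = \<phi>2" unfolding E_def by auto
qed

lemma free_ns_algebra_universal:
  assumes "free_ns_algebra sV \<iota> sN prec succ bul"
    and "ns_algebra t C prec' succ' bul'" "Vector_Spaces.linear sV t f" "range f \<subseteq> C"
  shows "\<exists>!\<phi>. ns_hom_into sN prec succ bul t C prec' succ' bul' \<phi> \<and> \<phi> \<circ> \<iota> = f"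
proof -
  have c: "ns_algebra_if_comm False s A p q b \<longleftrightarrow> ns_algebra s A p q b"
    for s :: "'k::field \<Rightarrow> 'z::ab_group_add \<Rightarrow> 'z" and A p q b
    unfolding ns_algebra_if_comm_def by simp
  note F = assms(1)[unfolded free_ns_algebra_def]
  show ?thesis
    by (rule free_universal_aux[where c = False, unfolded c, OF F[THEN conjunct1]
          F[THEN conjunct2, THEN conjunct1] _ assms(2-4)])
      (rule F[THEN conjunct2, THEN conjunct2, rule_format], intro conjI)
qed

lemma free_comm_ns_algebra_universal:
  assumes "free_comm_ns_algebra sV \<iota> sN prec succ bul"
    and "comm_ns_algebra t C prec' succ' bul'" "Vector_Spaces.linear sV t f" "range f \<subseteq> C"
  shows "\<exists>!\<phi>. ns_hom_into sN prec succ bul t C prec' succ' bul' \<phi> \<and> \<phi> \<circ> \<iota> = f"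
proof -
  have c: "ns_algebra_if_comm True s A p q b \<longleftrightarrow> comm_ns_algebra s A p q b"
    for s :: "'k::field \<Rightarrow> 'z::ab_group_add \<Rightarrow> 'z" and A p q b
    unfolding ns_algebra_if_comm_def comm_ns_algebra_def by auto
  note F = assms(1)[unfolded free_comm_ns_algebra_def]
  show ?thesis
    by (rule free_universal_aux[where c = True, unfolded c, OF F[THEN conjunct1]
          F[THEN conjunct2, THEN conjunct1] _ assms(2-4)])
      (rule F[THEN conjunct2, THEN conjunct2, rule_format], intro conjI)
qed

section \<open>The augmentation \<open>k1 \<oplus> N\<close>\<close>

text \<open>The pair \<open>(a, x)\<close> stands for \<open>a1 + x\<close>.\<close>

definition aug_scale :: "('k::field \<Rightarrow> 'a \<Rightarrow> 'a) \<Rightarrow> 'k \<Rightarrow> 'k \<times> 'a \<Rightarrow> 'k \<times> 'a"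
  where "aug_scale s c p = (c * fst p, s c (snd p))"

definition aug_mult ::
    "('k::field \<Rightarrow> 'a::ab_group_add \<Rightarrow> 'a) \<Rightarrow> ('a \<Rightarrow> 'a \<Rightarrow> 'a) \<Rightarrow> 'k \<times> 'a \<Rightarrow> 'k \<times> 'a \<Rightarrow> 'k \<times> 'a"
  where "aug_mult s star p q =
    (fst p * fst q, s (fst p) (snd q) + s (fst q) (snd p) + star (snd p) (snd q))"

definition aug_one :: "'k::field \<times> 'a::ab_group_add"
  where "aug_one = (1, 0)"

section \<open>Tensor products\<close>

text \<open>\<open>H \<otimes> H\<close> is the space with basis \<open>H \<times> H\<close> modulo the subspace spanned by the bilinearity
  relations.  Its elements are handled through representatives, equality being \<open>tensor2_eq\<close>;
  likewise for \<open>H \<otimes> H \<otimes> H\<close>.\<close>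

definition pure :: "'x \<Rightarrow> ('x \<Rightarrow>\<^sub>0 'k::field)"
  where "pure x = Poly_Mapping.single x 1"

definition tensor2_rel ::
    "('k::field \<Rightarrow> 'h::ab_group_add \<Rightarrow> 'h) \<Rightarrow> ('h \<times> 'h \<Rightarrow>\<^sub>0 'k) set"
  where "tensor2_rel s = module.span fscale
    ({pure (x + x', y) - pure (x, y) - pure (x', y) | x x' y. True} \<union>
     {pure (x, y + y') - pure (x, y) - pure (x, y') | x y y'. True} \<union>
     {pure (s c x, y) - fscale c (pure (x, y)) | c x y. True} \<union>
     {pure (x, s c y) - fscale c (pure (x, y)) | c x y. True})"

definition tensor2_eq ::
    "('k::field \<Rightarrow> 'h::ab_group_add \<Rightarrow> 'h) \<Rightarrow> ('h \<times> 'h \<Rightarrow>\<^sub>0 'k) \<Rightarrow> ('h \<times> 'h \<Rightarrow>\<^sub>0 'k) \<Rightarrow> bool"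
  where "tensor2_eq s u v \<longleftrightarrow> u - v \<in> tensor2_rel s"

definition tensor3_rel ::
    "('k::field \<Rightarrow> 'h::ab_group_add \<Rightarrow> 'h) \<Rightarrow> ('h \<times> 'h \<times> 'h \<Rightarrow>\<^sub>0 'k) set"
  where "tensor3_rel s = module.span fscale
    ({pure (x + x', y, z) - pure (x, y, z) - pure (x', y, z) | x x' y z. True} \<union>
     {pure (x, y + y', z) - pure (x, y, z) - pure (x, y', z) | x y y' z. True} \<union>
     {pure (x, y, z + z') - pure (x, y, z) - pure (x, y, z') | x y z z'. True} \<union>
     {pure (s c x, y, z) - fscale c (pure (x, y, z)) | c x y z. True} \<union>
     {pure (x, s c y, z) - fscale c (pure (x, y, z)) | c x y z. True} \<union>
     {pure (x, y, s c z) - fscale c (pure (x, y, z)) | c x y z. True})"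

definition tensor3_eq ::
    "('k::field \<Rightarrow> 'h::ab_group_add \<Rightarrow> 'h) \<Rightarrow> ('h \<times> 'h \<times> 'h \<Rightarrow>\<^sub>0 'k) \<Rightarrow> ('h \<times> 'h \<times> 'h \<Rightarrow>\<^sub>0 'k) \<Rightarrow> bool"
  where "tensor3_eq s u v \<longleftrightarrow> u - v \<in> tensor3_rel s"

text \<open>\<open>lin_ext t f\<close> is the linear map sending the basis element \<open>x\<close> to \<open>f x\<close>.\<close>

definition lin_ext :: "('k::field \<Rightarrow> 'm::ab_group_add \<Rightarrow> 'm) \<Rightarrow> ('x \<Rightarrow> 'm) \<Rightarrow> ('x \<Rightarrow>\<^sub>0 'k) \<Rightarrow> 'm"
  where "lin_ext t f u = (\<Sum>x\<in>Poly_Mapping.keys u. t (Poly_Mapping.lookup u x) (f x))"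

definition tensor2_mult ::
    "('h \<Rightarrow> 'h \<Rightarrow> 'h) \<Rightarrow> ('h \<times> 'h \<Rightarrow>\<^sub>0 'k::field) \<Rightarrow> ('h \<times> 'h \<Rightarrow>\<^sub>0 'k) \<Rightarrow> ('h \<times> 'h \<Rightarrow>\<^sub>0 'k)"
  where "tensor2_mult m u v =
    lin_ext fscale (\<lambda>(x, y). lin_ext fscale (\<lambda>(x', y'). pure (m x x', m y y')) v) u"

text \<open>\<open>\<Delta> \<otimes> id\<close> and \<open>id \<otimes> \<Delta>\<close>.\<close>

definition comult_left ::
    "('h \<Rightarrow> ('h \<times> 'h \<Rightarrow>\<^sub>0 'k::field)) \<Rightarrow> ('h \<times> 'h \<Rightarrow>\<^sub>0 'k) \<Rightarrow> ('h \<times> 'h \<times> 'h \<Rightarrow>\<^sub>0 'k)"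
  where "comult_left \<Delta> = lin_ext fscale (\<lambda>(x, y). lin_ext fscale (\<lambda>(a, b). pure (a, b, y)) (\<Delta> x))"

definition comult_right ::
    "('h \<Rightarrow> ('h \<times> 'h \<Rightarrow>\<^sub>0 'k::field)) \<Rightarrow> ('h \<times> 'h \<Rightarrow>\<^sub>0 'k) \<Rightarrow> ('h \<times> 'h \<times> 'h \<Rightarrow>\<^sub>0 'k)"
  where "comult_right \<Delta> = lin_ext fscale (\<lambda>(x, y). lin_ext fscale (\<lambda>(a, b). pure (x, a, b)) (\<Delta> y))"

section \<open>Connected Hopf algebras\<close>

locale bialgebra = vector_space scale
  for scale :: "'k::field \<Rightarrow> 'h::ab_group_add \<Rightarrow> 'h" +
  fixes mult :: "'h \<Rightarrow> 'h \<Rightarrow> 'h"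
    and unit :: 'h
    and \<Delta> :: "'h \<Rightarrow> ('h \<times> 'h \<Rightarrow>\<^sub>0 'k)"
    and \<kappa> :: "'h \<Rightarrow> 'k"
  assumes mult_bilinear: "bilinear_op_on scale UNIV mult"
    and mult_assoc: "mult (mult x y) z = mult x (mult y z)"
    and mult_unit_left: "mult unit x = x"
    and mult_unit_right: "mult x unit = x"
    and comult_add: "tensor2_eq scale (\<Delta> (x + y)) (\<Delta> x + \<Delta> y)"
    and comult_scale: "tensor2_eq scale (\<Delta> (scale c x)) (fscale c (\<Delta> x))"
    and counit_linear: "Vector_Spaces.linear scale (*) \<kappa>"
    and coassoc: "tensor3_eq scale (comult_left \<Delta> (\<Delta> x)) (comult_right \<Delta> (\<Delta> x))"
    and counit_left: "lin_ext scale (\<lambda>(y, z). scale (\<kappa> y) z) (\<Delta> x) = x"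
    and counit_right: "lin_ext scale (\<lambda>(y, z). scale (\<kappa> z) y) (\<Delta> x) = x"
    and comult_mult: "tensor2_eq scale (\<Delta> (mult x y)) (tensor2_mult mult (\<Delta> x) (\<Delta> y))"
    and comult_unit: "tensor2_eq scale (\<Delta> unit) (pure (unit, unit))"
    and counit_mult: "\<kappa> (mult x y) = \<kappa> x * \<kappa> y"
    and counit_unit: "\<kappa> unit = 1"

primrec conn_filtration ::
    "('k::field \<Rightarrow> 'h::ab_group_add \<Rightarrow> 'h) \<Rightarrow> 'h \<Rightarrow> ('h \<Rightarrow> ('h \<times> 'h \<Rightarrow>\<^sub>0 'k)) \<Rightarrow> nat \<Rightarrow> 'h set"
  where
    "conn_filtration s e \<Delta> 0 = range (\<lambda>c. s c e)"
  | "conn_filtration s e \<Delta> (Suc r) =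
      {x. \<exists>u \<in> module.span fscale {pure (a, b) | a b.
                  a \<in> conn_filtration s e \<Delta> r \<and> b \<in> conn_filtration s e \<Delta> r}.
            tensor2_eq s (\<Delta> x - pure (e, x) - pure (x, e)) u}"

text \<open>The existence of the antipode is included, although it follows from connectedness.\<close>

locale connected_hopf_algebra = bialgebra +
  assumes connected: "(\<Union>r. conn_filtration scale unit \<Delta> r) = UNIV"
    and antipode: "\<exists>S. Vector_Spaces.linear scale scale S \<and>
      (\<forall>x. lin_ext scale (\<lambda>(y, z). mult (S y) z) (\<Delta> x) = scale (\<kappa> x) unit \<and>
           lin_ext scale (\<lambda>(y, z). mult y (S z)) (\<Delta> x) = scale (\<kappa> x) unit)"

end

theory Submission
  imports Defs
begin

text \<open>Let \<open>H = k1 \<oplus> N\<close>.  The augmentation ideal of \<open>H \<otimes> H\<close> is an NS-algebra, commutative if \<open>N\<close> is: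
  the operations are \<open>(a \<otimes> b) \<circ> (a' \<otimes> b') = (a \<star> a') \<otimes> (b \<circ> b')\<close>, except that
  \<open>(a \<otimes> 1) \<circ> (a' \<otimes> 1) = (a \<circ> a') \<otimes> 1\<close>, with \<open>x \<prec> 1 = x = 1 \<succ> x\<close> and
  \<open>1 \<prec> x = x \<succ> 1 = 1 \<bullet> x = x \<bullet> 1 = 0\<close>.  By freeness, \<open>v \<mapsto> v \<otimes> 1 + 1 \<otimes> v\<close> on \<open>V\<close> extends to an
  NS-morphism \<open>\<Delta>\<close>.  It is multiplicative for \<open>\<star>\<close>, and the counit and coassociativity laws need
  only be checked on \<open>V\<close>, since \<open>N\<close> is generated by \<open>V\<close>.  The filtration of \<open>N\<close> by the number of
  generators in a monomial is respected by \<open>\<Delta>\<close>, which gives connectedness, and makes the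
  geometric series for the antipode finite on every element.\<close>

section \<open>Free vector spaces and normal forms of tensors\<close>

interpretation free: vector_space "fscale :: 'k::field \<Rightarrow> ('x \<Rightarrow>\<^sub>0 'k) \<Rightarrow> _"
  by (rule vector_space_fscale)

lemma fscale_pure: "fscale c (pure x) = Poly_Mapping.single x c"
  by (rule poly_mapping_eqI) (simp add: pure_def lookup_single when_def)

section \<open>Induction over linear combinations of basis elements\<close>

lemma free_induct [case_names pure add scale]:
  fixes u :: "'x \<Rightarrow>\<^sub>0 'k::field"
  assumes "\<And>x. P (pure x)" "\<And>u v. P u \<Longrightarrow> P v \<Longrightarrow> P (u + v)" "\<And>c u. P u \<Longrightarrow> P (fscale c u)"
  shows "P u"
proof -
  have 0: "P 0" using assms(3)[OF assms(1), of 0] by simp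
  have "P (\<Sum>x\<in>A. Poly_Mapping.single x (Poly_Mapping.lookup u x))" if "finite A" for A
    using that by (induction A) (auto simp: 0 fscale_pure[symmetric] intro: assms)
  moreover have "u = (\<Sum>x\<in>Poly_Mapping.keys u. Poly_Mapping.single x (Poly_Mapping.lookup u x))"
    by (rule poly_mapping_eqI) (auto simp: lookup_sum lookup_single when_def in_keys_iff)
  ultimately show ?thesis by (metis finite_keys)
qed

lemma free_induct2 [case_names pure add1 scale1 add2 scale2]:
  fixes u v :: "'x \<times> 'y \<Rightarrow>\<^sub>0 'k::field"
  assumes "\<And>a b c d. P (pure (a, b)) (pure (c, d))"
    "\<And>u u' v. P u v \<Longrightarrow> P u' v \<Longrightarrow> P (u + u') v" "\<And>c u v. P u v \<Longrightarrow> P (fscale c u) v"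
    "\<And>u v v'. P u v \<Longrightarrow> P u v' \<Longrightarrow> P u (v + v')" "\<And>c u v. P u v \<Longrightarrow> P u (fscale c v)"
  shows "P u v"
proof (induction u rule: free_induct)
  case (pure x)
  show ?case by (induction v rule: free_induct; cases x) (auto intro: assms)
qed (auto intro: assms)

lemma free_induct3 [case_names pure add1 scale1 add2 scale2 add3 scale3]:
  fixes u v w :: "'x \<times> 'y \<Rightarrow>\<^sub>0 'k::field"
  assumes "\<And>a b c d e f. P (pure (a, b)) (pure (c, d)) (pure (e, f))"
    "\<And>u u' v w. P u v w \<Longrightarrow> P u' v w \<Longrightarrow> P (u + u') v w" "\<And>c u v w. P u v w \<Longrightarrow> P (fscale c u) v w"
    "\<And>u v v' w. P u v w \<Longrightarrow> P u v' w \<Longrightarrow> P u (v + v') w" "\<And>c u v w. P u v w \<Longrightarrow> P u (fscale c v) w"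
    "\<And>u v w w'. P u v w \<Longrightarrow> P u v w' \<Longrightarrow> P u v (w + w')" "\<And>c u v w. P u v w \<Longrightarrow> P u v (fscale c w)"
  shows "P u v w"
proof (induction u v rule: free_induct2)
  case (pure a b c d)
  show ?case
  proof (induction w rule: free_induct)
    case (pure x)
    show ?case by (cases x) (simp add: assms(1))
  qed (auto intro: assms)
qed (auto intro: assms)

lemma bilinear_on_UNIV_simps:
  assumes "vector_space s" "bilinear_op_on s UNIV m"
  shows "m (x + y) z = m x z + m y z" "m z (x + y) = m z x + m z y"
    "m (s c x) y = s c (m x y)" "m x (s c y) = s c (m x y)"
    "m 0 x = 0" "m x 0 = 0" "m (x - y) z = m x z - m y z" "m z (x - y) = m z x - m z y"
proof -
  interpret vector_space s by fact
  show a: "m (x + y) z = m x z + m y z" "m z (x + y) = m z x + m z y"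
    "m (s c x) y = s c (m x y)" "m x (s c y) = s c (m x y)"
    for x y z c using assms(2) unfolding bilinear_op_on_def by blast+
  show "m 0 x = 0" "m x 0 = 0" using a(3)[of 0 0 x] a(4)[of x 0 0] by simp_all
  show "m (x - y) z = m x z - m y z" "m z (x - y) = m z x - m z y"
    by (simp_all only: eq_diff_eq a[symmetric] diff_add_cancel)
qed

section \<open>Linear extension from a basis\<close>

context
  fixes t :: "'k::field \<Rightarrow> 'm::ab_group_add \<Rightarrow> 'm"
  assumes t: "vector_space t"
begin

interpretation t: vector_space t by (rule t)

lemma lin_ext_superset:
  assumes "finite A" "Poly_Mapping.keys u \<subseteq> A"
  shows "lin_ext t f u = (\<Sum>x\<in>A. t (Poly_Mapping.lookup u x) (f x))"
  unfolding lin_ext_def using assms by (intro sum.mono_neutral_left) (auto simp: in_keys_iff)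

lemma lin_ext_add: "lin_ext t f (u + v) = lin_ext t f u + lin_ext t f v"
proof -
  let ?A = "Poly_Mapping.keys u \<union> Poly_Mapping.keys v"
  have "Poly_Mapping.keys (u + v) \<subseteq> ?A" by (rule keys_add)
  then show ?thesis
    by (simp add: lin_ext_superset[where A = ?A] lookup_add t.scale_left_distrib sum.distrib)
qed

lemma lin_ext_fscale: "lin_ext t f (fscale c u) = t c (lin_ext t f u)"
proof -
  have "Poly_Mapping.keys (fscale c u) \<subseteq> Poly_Mapping.keys u" by (auto simp: in_keys_iff)
  then show ?thesis
    by (simp add: lin_ext_superset[where A = "Poly_Mapping.keys u"] t.scale_sum_right)
qed

lemma lin_ext_pure: "lin_ext t f (pure x) = f x"
  by (simp add: lin_ext_def pure_def)

lemma linear_lin_ext: "Vector_Spaces.linear fscale t (lin_ext t f)"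
  using t vector_space_fscale
  by (simp add: Vector_Spaces.linear_def module_hom_def module_hom_axioms_def lin_ext_add
      lin_ext_fscale module_iff_vector_space)

lemmas lin_ext_simps = lin_ext_add lin_ext_fscale lin_ext_pure

end

lemmas lin_ext_fscale_simps [simp] = lin_ext_simps[OF vector_space_fscale]

lemma vector_space_mult: "vector_space ((*) :: 'k::field \<Rightarrow> 'k \<Rightarrow> 'k)"
  by unfold_locales (auto simp: algebra_simps)

lemmas lin_ext_mult_simps [simp] = lin_ext_simps[OF vector_space_mult]

text \<open>Normal forms modulo \<open>R\<close> turn the congruences \<open>tensor2_eq\<close> and \<open>tensor3_eq\<close> into equations
  inside the free space, so that \<open>H \<otimes> H\<close> becomes a subspace that can carry an NS-algebra.\<close>

definition is_nf :: "('x \<Rightarrow>\<^sub>0 'k::field) set \<Rightarrow> (('x \<Rightarrow>\<^sub>0 'k) \<Rightarrow> ('x \<Rightarrow>\<^sub>0 'k)) \<Rightarrow> bool"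
  where "is_nf R n \<longleftrightarrow> Vector_Spaces.linear fscale fscale n \<and> (\<forall>u\<in>R. n u = 0) \<and> (\<forall>u. u - n u \<in> R)"

text \<open>A projection onto a complement of \<open>R\<close>: a basis \<open>B\<close> of
  \<open>R\<close> is extended to a basis \<open>C\<close> of the whole space, and \<open>n\<close>
  kills \<open>B\<close> and fixes the remaining elements of \<open>C\<close>.\<close>

lemma is_nf_exists:
  fixes R :: "('x \<Rightarrow>\<^sub>0 'k::field) set"
  assumes R: "free.subspace R"
  shows "\<exists>n. is_nf R n"
proof -
  interpret pair: vector_space_pair "fscale :: 'k \<Rightarrow> ('x \<Rightarrow>\<^sub>0 'k) \<Rightarrow> _" "fscale :: 'k \<Rightarrow> ('x \<Rightarrow>\<^sub>0 'k) \<Rightarrow> _" ..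
  obtain B where B: "B \<subseteq> R" "free.independent B" "R \<subseteq> free.span B"
    using free.maximal_independent_subset[of R] by blast
  define C where "C = free.extend_basis B"
  have C: "B \<subseteq> C" "free.independent C" "free.span C = UNIV"
    unfolding C_def using free.extend_basis_superset free.independent_extend_basis
      free.span_extend_basis B(2) by auto
  obtain n where n: "Vector_Spaces.linear fscale fscale n"
    and nC: "\<And>c. c \<in> C \<Longrightarrow> n c = (if c \<in> B then 0 else c)"
    using pair.linear_independent_extend[OF C(2), of "\<lambda>c. if c \<in> B then 0 else c"] by blast
  interpret n: Vector_Spaces.linear fscale fscale n by (rule n)
  have "n u = 0" if "u \<in> R" for u
  proof -
    have "u \<in> free.span B" using B(3) that by blast
    then show ?thesis
      by (induction rule: free.span_induct_alt) (use nC C(1) in \<open>auto simp: n.add n.scale\<close>)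
  qed
  moreover have "u - n u \<in> R" for u
  proof -
    have "u \<in> free.span C" using C(3) by blast
    then show ?thesis
    proof (induction rule: free.span_induct_alt)
      case base then show ?case using free.subspace_0[OF R] by simp
    next
      case (step c x y)
      have "x - n x \<in> R" using nC[OF step(1)] B(1) free.subspace_0[OF R] by auto
      moreover have "fscale c x + y - n (fscale c x + y) = fscale c (x - n x) + (y - n y)"
        by (simp add: n.add n.scale free.scale_right_diff_distrib)
      ultimately show ?case
        using step(2) free.subspace_add[OF R] free.subspace_scale[OF R] by metis
    qed
  qed
  ultimately show ?thesis using n unfolding is_nf_def by blast
qed

definition nf :: "('x \<Rightarrow>\<^sub>0 'k::field) set \<Rightarrow> ('x \<Rightarrow>\<^sub>0 'k) \<Rightarrow> ('x \<Rightarrow>\<^sub>0 'k)"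
  where "nf R = (SOME n. is_nf R n)"

lemma is_nf_nf: "free.subspace R \<Longrightarrow> is_nf R (nf R)"
  unfolding nf_def by (rule someI_ex[OF is_nf_exists])

lemma
  assumes "free.subspace R"
  shows linear_nf: "Vector_Spaces.linear fscale fscale (nf R)"
    and nf_eq_0: "u \<in> R \<Longrightarrow> nf R u = 0"
    and diff_nf: "u - nf R u \<in> R"
  using is_nf_nf[OF assms] unfolding is_nf_def by auto

lemma nf_nf:
  assumes "free.subspace R"
  shows "nf R (nf R u) = nf R u"
proof -
  interpret Vector_Spaces.linear fscale fscale "nf R" by (rule linear_nf[OF assms])
  show ?thesis using nf_eq_0[OF assms diff_nf[OF assms, of u]] by (simp add: diff)
qed

lemma diff_in_iff_nf_eq:
  assumes "free.subspace R"
  shows "u - v \<in> R \<longleftrightarrow> nf R u = nf R v"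
proof -
  interpret Vector_Spaces.linear fscale fscale "nf R" by (rule linear_nf[OF assms])
  show ?thesis using nf_eq_0[OF assms, of "u - v"] diff_nf[OF assms, of "u - v"] by (auto simp: diff)
qed

section \<open>Tensor squares and cubes in normal form\<close>

locale tensor_space = vector_space scale
  for scale :: "'k::field \<Rightarrow> 'h::ab_group_add \<Rightarrow> 'h"
begin

definition "nf2 = nf (tensor2_rel scale)"
definition "nf3 = nf (tensor3_rel scale)"
definition "tens x y = nf2 (pure (x, y))"
definition "tens3 x y z = nf3 (pure (x, y, z))"

lemma subspace_tensor2_rel: "free.subspace (tensor2_rel scale)"
  unfolding tensor2_rel_def by (rule free.subspace_span)

lemma subspace_tensor3_rel: "free.subspace (tensor3_rel scale)"
  unfolding tensor3_rel_def by (rule free.subspace_span)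

sublocale nf2: Vector_Spaces.linear fscale fscale nf2
  unfolding nf2_def by (rule linear_nf[OF subspace_tensor2_rel])

sublocale nf3: Vector_Spaces.linear fscale fscale nf3
  unfolding nf3_def by (rule linear_nf[OF subspace_tensor3_rel])

lemma nf2_nf2 [simp]: "nf2 (nf2 u) = nf2 u"
  unfolding nf2_def by (rule nf_nf[OF subspace_tensor2_rel])

lemma nf2_tens [simp]: "nf2 (tens x y) = tens x y"
  by (simp add: tens_def)

lemma tensor2_eq_iff: "tensor2_eq scale u v \<longleftrightarrow> nf2 u = nf2 v"
  unfolding tensor2_eq_def nf2_def by (rule diff_in_iff_nf_eq[OF subspace_tensor2_rel])

lemma tensor3_eq_iff: "tensor3_eq scale u v \<longleftrightarrow> nf3 u = nf3 v"
  unfolding tensor3_eq_def nf3_def by (rule diff_in_iff_nf_eq[OF subspace_tensor3_rel])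

text \<open>Each law is one of the generators of \<open>tensor2_rel\<close>, so both sides have the
  same normal form.\<close>

lemma tens_simps [simp]:
  "tens (x + x') y = tens x y + tens x' y" "tens x (y + y') = tens x y + tens x y'"
  "tens (scale c x) y = fscale c (tens x y)" "tens x (scale c y) = fscale c (tens x y)"
proof -
  have 1: "nf2 u = nf2 v" if "u - v \<in> tensor2_rel scale" for u v
    using that tensor2_eq_iff unfolding tensor2_eq_def by blast
  show "tens (x + x') y = tens x y + tens x' y" "tens x (y + y') = tens x y + tens x y'"
    "tens (scale c x) y = fscale c (tens x y)" "tens x (scale c y) = fscale c (tens x y)"
    unfolding tens_def nf2.add[symmetric] nf2.scale[symmetric]
    by (-, (rule 1, unfold tensor2_rel_def diff_diff_eq[symmetric], rule free.span_base, blast)+)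
qed

lemma tens3_simps [simp]:
  "tens3 (x + x') y z = tens3 x y z + tens3 x' y z"
  "tens3 x (y + y') z = tens3 x y z + tens3 x y' z"
  "tens3 x y (z + z') = tens3 x y z + tens3 x y z'"
  "tens3 (scale c x) y z = fscale c (tens3 x y z)" "tens3 x (scale c y) z = fscale c (tens3 x y z)"
  "tens3 x y (scale c z) = fscale c (tens3 x y z)"
proof -
  have 1: "nf3 u = nf3 v" if "u - v \<in> tensor3_rel scale" for u v
    using that tensor3_eq_iff unfolding tensor3_eq_def by blast
  show "tens3 (x + x') y z = tens3 x y z + tens3 x' y z"
    "tens3 x (y + y') z = tens3 x y z + tens3 x y' z"
    "tens3 x y (z + z') = tens3 x y z + tens3 x y z'"
    "tens3 (scale c x) y z = fscale c (tens3 x y z)" "tens3 x (scale c y) z = fscale c (tens3 x y z)"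
    "tens3 x y (scale c z) = fscale c (tens3 x y z)"
    unfolding tens3_def nf3.add[symmetric] nf3.scale[symmetric]
    by (-, (rule 1, unfold tensor3_rel_def diff_diff_eq[symmetric], rule free.span_base, simp only: Un_iff mem_Collect_eq, metis)+)
qed

lemma tens_zero [simp]: "tens 0 y = 0" "tens x 0 = 0"
  using tens_simps(3)[of 0 0 y] tens_simps(4)[of x 0 0] by simp_all

lemma tens_diff [simp]:
  "tens (x - x') y = tens x y - tens x' y" "tens x (y - y') = tens x y - tens x y'"
  by (simp_all only: eq_diff_eq tens_simps(1,2)[symmetric] diff_add_cancel)

lemma tens_minus [simp]: "tens (- x) y = - tens x y" "tens x (- y) = - tens x y"
  using tens_diff(1)[of 0 x y] tens_diff(2)[of x 0 y] by simp_all

text \<open>The linear extension of a bilinear map kills the generators of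
  \<open>tensor2_rel\<close>, hence also \<open>u - nf2 u\<close>. This is the universal property of
  the tensor product: such a map may be evaluated on any representative.\<close>

lemma tensor2_rel_lift:
  assumes t: "vector_space t"
    and f: "\<And>x x' y. f (x + x') y = f x y + f x' y" "\<And>x y y'. f x (y + y') = f x y + f x y'"
      "\<And>c x y. f (scale c x) y = t c (f x y)" "\<And>c x y. f x (scale c y) = t c (f x y)"
  shows "lin_ext t (\<lambda>(x, y). f x y) (nf2 u) = lin_ext t (\<lambda>(x, y). f x y) u"
proof -
  let ?L = "lin_ext t (\<lambda>(x, y). f x y)"
  interpret L: Vector_Spaces.linear fscale t ?L by (rule linear_lin_ext[OF t])
  have "tensor2_rel scale \<subseteq> {u. ?L u = 0}"
    unfolding tensor2_rel_def by (rule free.span_minimal[OF _ L.subspace_kernel])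
      (auto simp: L.diff lin_ext_simps[OF t] f)
  moreover have "u - nf2 u \<in> tensor2_rel scale"
    unfolding nf2_def by (rule diff_nf[OF subspace_tensor2_rel])
  ultimately have "?L (u - nf2 u) = 0" by blast
  then show ?thesis by (simp add: L.diff)
qed

lemma tensor3_rel_lift:
  assumes t: "vector_space t"
    and f: "\<And>x x' y z. f (x + x') y z = f x y z + f x' y z"
      "\<And>x y y' z. f x (y + y') z = f x y z + f x y' z"
      "\<And>x y z z'. f x y (z + z') = f x y z + f x y z'"
      "\<And>c x y z. f (scale c x) y z = t c (f x y z)"
      "\<And>c x y z. f x (scale c y) z = t c (f x y z)"
      "\<And>c x y z. f x y (scale c z) = t c (f x y z)"
  shows "lin_ext t (\<lambda>(x, y, z). f x y z) (nf3 u) = lin_ext t (\<lambda>(x, y, z). f x y z) u"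
proof -
  let ?L = "lin_ext t (\<lambda>(x, y, z). f x y z)"
  interpret L: Vector_Spaces.linear fscale t ?L by (rule linear_lin_ext[OF t])
  have "tensor3_rel scale \<subseteq> {u. ?L u = 0}"
    unfolding tensor3_rel_def by (rule free.span_minimal[OF _ L.subspace_kernel])
      (auto simp: L.diff lin_ext_simps[OF t] f)
  moreover have "u - nf3 u \<in> tensor3_rel scale"
    unfolding nf3_def by (rule diff_nf[OF subspace_tensor3_rel])
  ultimately have "?L (u - nf3 u) = 0" by blast
  then show ?thesis by (simp add: L.diff)
qed

end

section \<open>Augmented NS-algebras and their tensor squares\<close>

text \<open>Here \<open>prec\<close>, \<open>succ\<close>, \<open>bul\<close> extend the operations of an NS-algebra to \<open>k1 \<oplus> N\<close>, with the
  products of two copies of the unit set to \<open>0\<close>.  With this convention the NS-relations hold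
  for all arguments once \<open>\<star>\<close> is replaced by the unital product \<open>mul\<close>.\<close>

locale augmented_ns = tensor_space scale
  for scale :: "'k::field \<Rightarrow> 'h::ab_group_add \<Rightarrow> 'h" +
  fixes one :: 'h and \<kappa> :: "'h \<Rightarrow> 'k" and prec succ bul mul :: "'h \<Rightarrow> 'h \<Rightarrow> 'h"
  assumes linear_\<kappa>: "Vector_Spaces.linear scale (*) \<kappa>"
    and \<kappa>_one [simp]: "\<kappa> one = 1"
    and bil_prec: "bilinear_op_on scale UNIV prec"
    and bil_succ: "bilinear_op_on scale UNIV succ"
    and bil_bul: "bilinear_op_on scale UNIV bul"
    and mul_eq: "mul x y = prec x y + succ x y + bul x y + scale (\<kappa> x * \<kappa> y) one"
    and \<kappa>_op [simp]: "\<kappa> (prec x y) = 0" "\<kappa> (succ x y) = 0" "\<kappa> (bul x y) = 0"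
    and op_one [simp]: "prec one x = 0" "prec x one = x - scale (\<kappa> x) one"
      "succ one x = x - scale (\<kappa> x) one" "succ x one = 0" "bul one x = 0" "bul x one = 0"
    and rel1: "prec (prec x y) z = prec x (mul y z)"
    and rel2: "prec (succ x y) z = succ x (prec y z)"
    and rel3: "succ (mul x y) z = succ x (succ y z)"
    and rel4: "bul (mul x y) z + prec (bul x y) z = succ x (bul y z) + bul x (mul y z)"
begin

lemma \<kappa>_simps [simp]:
  "\<kappa> (x + y) = \<kappa> x + \<kappa> y" "\<kappa> (scale c x) = c * \<kappa> x" "\<kappa> (x - y) = \<kappa> x - \<kappa> y" "\<kappa> 0 = 0"
proof -
  interpret \<kappa>: Vector_Spaces.linear scale "(*)" \<kappa> by (rule linear_\<kappa>)
  show "\<kappa> (x + y) = \<kappa> x + \<kappa> y" "\<kappa> (scale c x) = c * \<kappa> x" "\<kappa> (x - y) = \<kappa> x - \<kappa> y" "\<kappa> 0 = 0"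
    by (rule \<kappa>.add \<kappa>.scale \<kappa>.diff \<kappa>.zero)+
qed

lemmas bilinear_simps = bilinear_on_UNIV_simps[OF vector_space_axioms]

lemmas op_simps [simp] = bilinear_simps[OF bil_prec] bilinear_simps[OF bil_succ] bilinear_simps[OF bil_bul]

lemma bil_mul: "bilinear_op_on scale UNIV mul"
  unfolding bilinear_op_on_def mul_eq
  by (simp add: algebra_simps scale_right_distrib)

lemmas mul_simps [simp] = bilinear_simps[OF bil_mul]

lemma \<kappa>_mul [simp]: "\<kappa> (mul x y) = \<kappa> x * \<kappa> y"
  by (simp add: mul_eq)

lemma mul_one [simp]: "mul one x = x" "mul x one = x"
  by (simp_all add: mul_eq)

text \<open>Associativity is the sum of the NS-relations, as for an NS-algebra without unit. The
  unit summands of the inner products disappear because \<open>prec one z\<close> and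
  \<open>succ x one\<close> are 0, and the outer ones agree since \<kappa> is multiplicative for
  \<open>mul\<close>.\<close>

lemma mul_assoc: "mul (mul x y) z = mul x (mul y z)"
proof -
  have "prec (mul x y) z = prec x (mul y z) + succ x (prec y z) + prec (bul x y) z"
    by (simp add: mul_eq[of x y] rel1 rel2)
  moreover have "succ x (mul y z) = succ x (prec y z) + succ x (succ y z) + succ x (bul y z)
      + scale (\<kappa> y * \<kappa> z) (succ x one)"
    by (simp only: mul_eq[of y z] op_simps)
  ultimately show ?thesis
    using rel3[of x y z] rel4[of x y z]
    by (simp add: mul_eq[of "mul x y"] mul_eq[of x "mul y z"] algebra_simps)
qed

text \<open>The summand with \<open>\<kappa> b * \<kappa> b'\<close> accounts for the case of a unit in both right factors,
  where \<open>m b b'\<close> vanishes.\<close>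

definition tprod :: "('h \<Rightarrow> 'h \<Rightarrow> 'h) \<Rightarrow> ('h \<times> 'h \<Rightarrow>\<^sub>0 'k) \<Rightarrow> ('h \<times> 'h \<Rightarrow>\<^sub>0 'k) \<Rightarrow> ('h \<times> 'h \<Rightarrow>\<^sub>0 'k)"
  where "tprod m u v = lin_ext fscale (\<lambda>(a, b). lin_ext fscale (\<lambda>(a', b').
    tens (mul a a') (m b b') + fscale (\<kappa> b * \<kappa> b') (tens (m a a') one)) v) u"

definition tmul :: "('h \<times> 'h \<Rightarrow>\<^sub>0 'k) \<Rightarrow> ('h \<times> 'h \<Rightarrow>\<^sub>0 'k) \<Rightarrow> ('h \<times> 'h \<Rightarrow>\<^sub>0 'k)"
  where "tmul u v = lin_ext fscale (\<lambda>(a, b). lin_ext fscale (\<lambda>(a', b').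
    tens (mul a a') (mul b b')) v) u"

text \<open>The maps \<kappa> \<otimes> \<kappa>, \<kappa> \<otimes> id and id \<otimes> \<kappa>;
  the first is the augmentation of the tensor square.\<close>

definition tcounit :: "('h \<times> 'h \<Rightarrow>\<^sub>0 'k) \<Rightarrow> 'k"
  where "tcounit = lin_ext (*) (\<lambda>(a, b). \<kappa> a * \<kappa> b)"

definition counitl :: "('h \<times> 'h \<Rightarrow>\<^sub>0 'k) \<Rightarrow> 'h"
  where "counitl = lin_ext scale (\<lambda>(a, b). scale (\<kappa> a) b)"

definition counitr :: "('h \<times> 'h \<Rightarrow>\<^sub>0 'k) \<Rightarrow> 'h"
  where "counitr = lin_ext scale (\<lambda>(a, b). scale (\<kappa> b) a)"

lemmas lin_ext_scale_simps [simp] = lin_ext_simps[OF vector_space_axioms]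

lemma tens_linear_simps [simp]:
  "tcounit (u + v) = tcounit u + tcounit v" "tcounit (fscale c u) = c * tcounit u"
  "tcounit (pure (a, b)) = \<kappa> a * \<kappa> b"
  "counitl (u + v) = counitl u + counitl v" "counitl (fscale c u) = scale c (counitl u)"
  "counitl (pure (a, b)) = scale (\<kappa> a) b"
  "counitr (u + v) = counitr u + counitr v" "counitr (fscale c u) = scale c (counitr u)"
  "counitr (pure (a, b)) = scale (\<kappa> b) a"
  by (simp_all add: tcounit_def counitl_def counitr_def)

lemma tcounit_nf2 [simp]: "tcounit (nf2 u) = tcounit u"
  unfolding tcounit_def by (rule tensor2_rel_lift[OF vector_space_mult]) (auto simp: algebra_simps)

lemma counitl_nf2 [simp]: "counitl (nf2 u) = counitl u"
  unfolding counitl_def by (rule tensor2_rel_lift[OF vector_space_axioms]) (auto simp: algebra_simps)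

lemma counitr_nf2 [simp]: "counitr (nf2 u) = counitr u"
  unfolding counitr_def by (rule tensor2_rel_lift[OF vector_space_axioms]) (auto simp: algebra_simps)

lemma counit_tens [simp]: "tcounit (tens a b) = \<kappa> a * \<kappa> b"
  "counitl (tens a b) = scale (\<kappa> a) b" "counitr (tens a b) = scale (\<kappa> b) a"
  unfolding tens_def by simp_all

lemma
  assumes "bilinear_op_on scale UNIV m"
  shows tprod_bilinear: "bilinear_op_on fscale UNIV (tprod m)"
    and tprod_pure: "tprod m (pure (a, b)) (pure (a', b')) =
      tens (mul a a') (m b b') + fscale (\<kappa> b * \<kappa> b') (tens (m a a') one)"
    and tprod_nf2: "tprod m (nf2 u) v = tprod m u v" "tprod m u (nf2 v) = tprod m u v"
      "nf2 (tprod m u v) = tprod m u v"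
proof -
  note m = bilinear_simps[OF assms]
  have r: "tprod m u (v + v') = tprod m u v + tprod m u v'"
    "tprod m u (fscale c v) = fscale c (tprod m u v)" for u v v' c
    by (induction u rule: free_induct)
      (auto simp: tprod_def free.scale_right_distrib mult.commute)
  then show "bilinear_op_on fscale UNIV (tprod m)"
    unfolding bilinear_op_on_def by (auto simp: tprod_def)
  show p: "tprod m (pure (a, b)) (pure (a', b')) =
      tens (mul a a') (m b b') + fscale (\<kappa> b * \<kappa> b') (tens (m a a') one)" for a b a' b'
    by (simp add: tprod_def)
  have l: "tprod m (pure (x + x', y)) v = tprod m (pure (x, y)) v + tprod m (pure (x', y)) v"
    "tprod m (pure (x, y + y')) v = tprod m (pure (x, y)) v + tprod m (pure (x, y')) v"
    "tprod m (pure (scale c x, y)) v = fscale c (tprod m (pure (x, y)) v)"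
    "tprod m (pure (x, scale c y)) v = fscale c (tprod m (pure (x, y)) v)" for x x' y y' c v
    by (induction v rule: free_induct; force simp: r p m algebra_simps)+
  show "tprod m (nf2 u) v = tprod m u v"
    unfolding tprod_def
    by (rule tensor2_rel_lift[OF vector_space_fscale])
      (use l[of _ _ _ v] in \<open>simp_all add: tprod_def\<close>)
  show "tprod m u (nf2 v) = tprod m u v"
  proof (induction u rule: free_induct)
    case (pure x)
    obtain a b where x: "x = (a, b)" by fastforce
    show ?case
      unfolding x tprod_def lin_ext_fscale_simps prod.case
      by (rule tensor2_rel_lift[OF vector_space_fscale])
        (simp_all add: m algebra_simps)
  qed (auto simp: tprod_def)
  \<comment> \<open>Values of \<open>tprod\<close> are combinations of elements
    \<open>tens x y\<close>, which are already in normal form.\<close>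
  have "nf2 (tprod m (pure (a, b)) v) = tprod m (pure (a, b)) v" for a b
    by (induction v rule: free_induct) (auto simp: r p nf2.add nf2.scale)
  then show "nf2 (tprod m u v) = tprod m u v"
    by (induction u rule: free_induct) (auto simp: tprod_def nf2.add nf2.scale)
qed


lemma tprod_tens:
  assumes "bilinear_op_on scale UNIV m"
  shows "tprod m (tens a b) v = tprod m (pure (a, b)) v" "tprod m u (tens a b) = tprod m u (pure (a, b))"
  unfolding tens_def by (rule tprod_nf2[OF assms])+

lemmas tprod_simps =
  bilinear_on_UNIV_simps[OF vector_space_fscale tprod_bilinear] tprod_nf2 tprod_pure tprod_tens

lemmas tprod_op_simps [simp] =
  tprod_simps[OF bil_prec] tprod_simps[OF bil_succ] tprod_simps[OF bil_bul]

section \<open>The NS-relations on the tensor square\<close>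

lemma tcounit_tprod [simp]:
  "tcounit (tprod prec u v) = 0" "tcounit (tprod succ u v) = 0" "tcounit (tprod bul u v) = 0"
  by (induction u v rule: free_induct2; simp)+

text \<open>Expanding \<open>mul b b'\<close> in the right factor gives the main terms of the three
  products. Its unit summand leaves \<open>mul a a'\<close> \<otimes> 1 with coefficient
  \<open>\<kappa> b * \<kappa> b'\<close>, and expanding \<open>mul a a'\<close> there gives the
  correction terms and the multiple of 1 \<otimes> 1.\<close>

lemma tmul_eq: "tmul u v = tprod prec u v + tprod succ u v + tprod bul u v
    + fscale (tcounit u * tcounit v) (tens one one)"
proof -
  have add: "tmul (u + u') v = tmul u v + tmul u' v" "tmul (fscale c u) v = fscale c (tmul u v)" for u u' v c
    by (simp_all add: tmul_def)
  have add2: "tmul u (v + v') = tmul u v + tmul u v'" "tmul u (fscale c v) = fscale c (tmul u v)" for u v v' c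
    by (induction u rule: free_induct)
      (auto simp: tmul_def free.scale_right_distrib mult.commute)
  have p: "tmul (pure (a, b)) (pure (a', b')) = tens (mul a a') (mul b b')" for a b a' b'
    by (simp add: tmul_def)
  show ?thesis
  proof (induction u v rule: free_induct2)
    case (pure a b c d)
    show ?case by (simp add: p mul_eq[of b d] mul_eq[of a c] algebra_simps free.scale_right_distrib)
  qed (simp_all add: add add2 algebra_simps free.scale_right_distrib)
qed

lemma tmul_pure [simp]: "tmul (pure (a, b)) (pure (a', b')) = tens (mul a a') (mul b b')"
  by (simp add: tmul_def)

lemma tmul_bilinear: "bilinear_op_on fscale UNIV tmul"
  unfolding bilinear_op_on_def tmul_eq by (simp add: algebra_simps free.scale_right_distrib)

lemmas tmul_simps [simp] = bilinear_on_UNIV_simps[OF vector_space_fscale tmul_bilinear]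

lemma tmul_nf2: "tmul u v = nf2 (tensor2_mult mul u v)"
proof -
  have T1: "tensor2_mult mul u (v + v') = tensor2_mult mul u v + tensor2_mult mul u v'"
    "tensor2_mult mul u (fscale c v) = fscale c (tensor2_mult mul u v)" for u v v' c
    by (induction u rule: free_induct)
      (auto simp: tensor2_mult_def free.scale_right_distrib mult.commute)
  have T2: "tensor2_mult mul (u + u') v = tensor2_mult mul u v + tensor2_mult mul u' v"
    "tensor2_mult mul (fscale c u) v = fscale c (tensor2_mult mul u v)" for u u' v c
    by (simp_all add: tensor2_mult_def)
  have T3: "nf2 (tensor2_mult mul (pure (a, b)) (pure (c, d))) = tens (mul a c) (mul b d)" for a b c d
    by (simp add: tensor2_mult_def tens_def)
  show ?thesis
    by (induction u v rule: free_induct2) (simp_all add: T1 T2 T3 nf2.add nf2.scale)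
qed

text \<open>The conventions for products with the unit hold again for 1 \<otimes> 1. They are what
  makes the coproduct compatible with the operations on the unit component of k1 \<oplus> N.\<close>

lemma tprod_one [simp]:
  "tprod prec (pure (one, one)) v = 0" "tprod succ u (pure (one, one)) = 0"
  "tprod bul (pure (one, one)) v = 0" "tprod bul u (pure (one, one)) = 0"
  "tprod prec u (pure (one, one)) = nf2 u - fscale (tcounit u) (tens one one)"
  "tprod succ (pure (one, one)) v = nf2 v - fscale (tcounit v) (tens one one)"
  subgoal by (induction v rule: free_induct) auto
  subgoal by (induction u rule: free_induct) auto
  subgoal by (induction v rule: free_induct) auto
  subgoal by (induction u rule: free_induct) auto
  subgoal by (induction u rule: free_induct)
      (auto simp: nf2.add nf2.scale tens_def[symmetric] add_diff_add mult_ac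
        free.scale_left_distrib free.scale_right_diff_distrib)
  subgoal by (induction v rule: free_induct)
      (auto simp: nf2.add nf2.scale tens_def[symmetric] add_diff_add mult_ac
        free.scale_left_distrib free.scale_right_diff_distrib)
  done

text \<open>On pure tensors the main terms agree by the relation in the right factor and
  associativity of \<open>mul\<close> in the left one. The correction terms agree by the relation in
  the left factor, and the mixed terms vanish by the unit conventions. The other three relations
  follow the same pattern.\<close>

lemma tprod_rel1: "tprod prec (tprod prec u v) w = tprod prec u (tmul v w)"
  by (induction u v w rule: free_induct3) (simp_all add: rel1 mul_assoc mult_ac)

lemma tprod_rel2: "tprod prec (tprod succ u v) w = tprod succ u (tprod prec v w)"
  by (induction u v w rule: free_induct3) (simp_all add: rel2 mul_assoc mult_ac)

lemma tprod_rel3: "tprod succ (tmul u v) w = tprod succ u (tprod succ v w)"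
  by (induction u v w rule: free_induct3) (simp_all add: rel3 mul_assoc mult_ac)

lemma tprod_rel4: "tprod bul (tmul u v) w + tprod prec (tprod bul u v) w =
    tprod succ u (tprod bul v w) + tprod bul u (tmul v w)"
proof -
  \<comment> \<open>The fourth relation is solved for one term so that it can be applied inside a
    tensor factor.\<close>
  have 4: "bul (mul x y) z = succ x (bul y z) + bul x (mul y z) - prec (bul x y) z" for x y z
    using rel4[of x y z] by (simp add: eq_diff_eq)
  have "tprod bul (tmul u v) w =
    tprod succ u (tprod bul v w) + tprod bul u (tmul v w) - tprod prec (tprod bul u v) w"
    by (induction u v w rule: free_induct3)
      (simp_all add: 4 mul_assoc mult_ac free.scale_right_diff_distrib free.scale_right_distrib)
  then show ?thesis by simp
qed

lemma tprod_comm: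
  assumes "\<And>x y. prec x y = succ y x" "\<And>x y. bul x y = bul y x"
  shows "tprod prec u v = tprod succ v u" "tprod bul u v = tprod bul v u"
proof -
  \<comment> \<open>The operation acts in one factor only; in the main term the left factors are
    multiplied by \<open>mul\<close>, which must commute as well.\<close>
  have mc: "mul x y = mul y x" for x y
    by (simp add: mul_eq assms(1)[of x y] assms(1)[of y x, symmetric] assms(2)[of x y] ac_simps)
  show "tprod prec u v = tprod succ v u"
  proof (induction u v rule: free_induct2)
    case (pure a b c d)
    show ?case by (simp add: assms(1)[of a c] assms(1)[of b d] mc[of a c] mult_ac)
  qed simp_all
  show "tprod bul u v = tprod bul v u"
  proof (induction u v rule: free_induct2)
    case (pure a b c d)
    show ?case by (simp add: assms(2)[of a c] assms(2)[of b d] mc[of a c] mult_ac)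
  qed simp_all
qed

text \<open>The augmentation ideal of H \<otimes> H. Restricting to normal forms makes it a subspace
  of a free vector space, so that it can serve as a target of the universal property.\<close>

definition taug :: "('h \<times> 'h \<Rightarrow>\<^sub>0 'k) set"
  where "taug = {u. nf2 u = u \<and> tcounit u = 0}"

lemma tcounit_zero [simp]: "tcounit 0 = 0"
  using tens_linear_simps(2)[of 0 0] by simp

lemma ns_algebra_taug:
  assumes "c \<longrightarrow> (\<forall>x y. prec x y = succ y x \<and> bul x y = bul y x)"
  shows "ns_algebra_if_comm c fscale taug (tprod prec) (tprod succ) (tprod bul)"
proof -
  have sub: "free.subspace taug"
    unfolding taug_def by (rule free.subspaceI) (auto simp: nf2.add nf2.scale)
  \<comment> \<open>On the augmentation ideal the unit summand in \<open>tmul_eq\<close> vanishes,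
    so the relations proved with \<open>tmul\<close> are the NS-relations.\<close>
  have star: "ns_star (tprod prec) (tprod succ) (tprod bul) u v = tmul u v" if "u \<in> taug" for u v
    using that by (simp add: ns_star_def tmul_eq taug_def)
  show ?thesis
    unfolding ns_algebra_if_comm_iff bilinear_op_on_def
    using sub assms tprod_comm
    by (auto simp: star vector_space_fscale tprod_rel1 tprod_rel2 tprod_rel3 tprod_rel4 taug_def)
qed

text \<open>The convention of \<open>tprod\<close> iterated: \<open>m\<close> acts in the last
  factor, and the two further summands cover units in the last factor and in the last two
  factors.\<close>

definition tprod3 :: "('h \<Rightarrow> 'h \<Rightarrow> 'h) \<Rightarrow> ('h \<times> 'h \<times> 'h \<Rightarrow>\<^sub>0 'k) \<Rightarrow> ('h \<times> 'h \<times> 'h \<Rightarrow>\<^sub>0 'k) \<Rightarrow> ('h \<times> 'h \<times> 'h \<Rightarrow>\<^sub>0 'k)"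
  where "tprod3 m u v = lin_ext fscale (\<lambda>(a, b, c). lin_ext fscale (\<lambda>(a', b', c').
    tens3 (mul a a') (mul b b') (m c c') + fscale (\<kappa> c * \<kappa> c') (tens3 (mul a a') (m b b') one) +
    fscale (\<kappa> b * \<kappa> b' * \<kappa> c * \<kappa> c') (tens3 (m a a') one one)) v) u"

lemma
  assumes "bilinear_op_on scale UNIV m"
  shows tprod3_bilinear: "bilinear_op_on fscale UNIV (tprod3 m)"
    and tprod3_pure: "tprod3 m (pure (a, b, c)) (pure (a', b', c')) =
      tens3 (mul a a') (mul b b') (m c c') + fscale (\<kappa> c * \<kappa> c') (tens3 (mul a a') (m b b') one) +
      fscale (\<kappa> b * \<kappa> b' * \<kappa> c * \<kappa> c') (tens3 (m a a') one one)"
    and tprod3_nf3: "tprod3 m (nf3 u) v = tprod3 m u v" "tprod3 m u (nf3 v) = tprod3 m u v"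
proof -
  note m = bilinear_simps[OF assms]
  have r: "tprod3 m u (v + v') = tprod3 m u v + tprod3 m u v'"
    "tprod3 m u (fscale c v) = fscale c (tprod3 m u v)" for u v v' c
    by (induction u rule: free_induct)
      (auto simp: tprod3_def free.scale_right_distrib mult.commute)
  then show "bilinear_op_on fscale UNIV (tprod3 m)"
    unfolding bilinear_op_on_def by (auto simp: tprod3_def)
  show p: "tprod3 m (pure (a, b, c)) (pure (a', b', c')) =
      tens3 (mul a a') (mul b b') (m c c') + fscale (\<kappa> c * \<kappa> c') (tens3 (mul a a') (m b b') one) +
      fscale (\<kappa> b * \<kappa> b' * \<kappa> c * \<kappa> c') (tens3 (m a a') one one)" for a b c a' b' c'
    by (simp add: tprod3_def)
  have l: "tprod3 m (pure (x + x', y, z)) v = tprod3 m (pure (x, y, z)) v + tprod3 m (pure (x', y, z)) v"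
    "tprod3 m (pure (x, y + y', z)) v = tprod3 m (pure (x, y, z)) v + tprod3 m (pure (x, y', z)) v"
    "tprod3 m (pure (x, y, z + z')) v = tprod3 m (pure (x, y, z)) v + tprod3 m (pure (x, y, z')) v"
    "tprod3 m (pure (scale c x, y, z)) v = fscale c (tprod3 m (pure (x, y, z)) v)"
    "tprod3 m (pure (x, scale c y, z)) v = fscale c (tprod3 m (pure (x, y, z)) v)"
    "tprod3 m (pure (x, y, scale c z)) v = fscale c (tprod3 m (pure (x, y, z)) v)"
    for x x' y y' z z' c v
    by (induction v rule: free_induct; force simp: r p m algebra_simps)+
  show "tprod3 m (nf3 u) v = tprod3 m u v"
    unfolding tprod3_def
    by (rule tensor3_rel_lift[OF vector_space_fscale])
      (use l[of _ _ _ _ v] l(3)[of _ _ _ _ v] in \<open>simp_all add: tprod3_def\<close>)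
  show "tprod3 m u (nf3 v) = tprod3 m u v"
  proof (induction u rule: free_induct)
    case (pure x)
    obtain a b c where x: "x = (a, b, c)" by (cases x)
    show ?case
      unfolding x tprod3_def lin_ext_fscale_simps prod.case
      by (rule tensor3_rel_lift[OF vector_space_fscale])
        (simp_all add: m algebra_simps)
  qed (auto simp: tprod3_def)
qed

lemma tprod3_tens3:
  assumes "bilinear_op_on scale UNIV m"
  shows "tprod3 m (tens3 a b c) v = tprod3 m (pure (a, b, c)) v"
    "tprod3 m u (tens3 a b c) = tprod3 m u (pure (a, b, c))"
  unfolding tens3_def by (rule tprod3_nf3[OF assms])+

lemmas tprod3_simps =
  bilinear_on_UNIV_simps[OF vector_space_fscale tprod3_bilinear] tprod3_nf3 tprod3_pure tprod3_tens3

definition tens3r :: "'h \<Rightarrow> ('h \<times> 'h \<Rightarrow>\<^sub>0 'k) \<Rightarrow> ('h \<times> 'h \<times> 'h \<Rightarrow>\<^sub>0 'k)"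
  where "tens3r z = lin_ext fscale (\<lambda>(a, b). tens3 a b z)"

definition tens3l :: "'h \<Rightarrow> ('h \<times> 'h \<Rightarrow>\<^sub>0 'k) \<Rightarrow> ('h \<times> 'h \<times> 'h \<Rightarrow>\<^sub>0 'k)"
  where "tens3l x = lin_ext fscale (\<lambda>(a, b). tens3 x a b)"

lemma tens3r_nf2 [simp]: "tens3r z (nf2 u) = tens3r z u"
  unfolding tens3r_def by (rule tensor2_rel_lift[OF vector_space_fscale]) auto

lemma tens3l_nf2 [simp]: "tens3l x (nf2 u) = tens3l x u"
  unfolding tens3l_def by (rule tensor2_rel_lift[OF vector_space_fscale]) auto

lemma tens3lr_simps [simp]:
  "tens3r z (u + v) = tens3r z u + tens3r z v" "tens3r z (fscale c u) = fscale c (tens3r z u)"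
  "tens3r z (pure (a, b)) = tens3 a b z" "tens3r z (tens a b) = tens3 a b z"
  "tens3l x (u + v) = tens3l x u + tens3l x v" "tens3l x (fscale c u) = fscale c (tens3l x u)"
  "tens3l x (pure (a, b)) = tens3 x a b" "tens3l x (tens a b) = tens3 x a b"
  by (simp_all add: tens_def) (simp_all add: tens3l_def tens3r_def)

lemma tens3lr_arg [simp]:
  "tens3r (z + z') u = tens3r z u + tens3r z' u" "tens3r (scale c z) u = fscale c (tens3r z u)"
  "tens3l (x + x') u = tens3l x u + tens3l x' u" "tens3l (scale c x) u = fscale c (tens3l x u)"
  by (induction u rule: free_induct; force simp: algebra_simps free.scale_right_distrib)+

text \<open>Bracketing as (H \<otimes> H) \<otimes> H recovers the formula of \<open>tprod\<close>,
  with \<open>tmul\<close> as the product of the left factors. Together with the next lemma it shows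
  that both bracketings give the same operation on the threefold tensor product.\<close>

lemma tprod3_tens3r:
  assumes m: "bilinear_op_on scale UNIV m"
  shows "tprod3 m (tens3r z u) (tens3r z' v) =
    tens3r (m z z') (tmul u v) + fscale (\<kappa> z * \<kappa> z') (tens3r one (tprod m u v))"
  by (induction u v rule: free_induct2)
    (simp_all add: tprod3_simps[OF m] tprod_simps[OF m] algebra_simps free.scale_right_distrib)

text \<open>In the bracketing H \<otimes> (H \<otimes> H) the right factor is a tensor, so
  \<open>tcounit\<close> takes the place of \<kappa> and 1 \<otimes> 1 that of the unit.\<close>

lemma tprod3_tens3l:
  assumes m: "bilinear_op_on scale UNIV m"
  shows "tprod3 m (tens3l x u) (tens3l x' v) =
    tens3l (mul x x') (tprod m u v) + fscale (tcounit u * tcounit v) (tens3 (m x x') one one)"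
  by (induction u v rule: free_induct2)
    (simp_all add: tprod3_simps[OF m] tprod_simps[OF m] algebra_simps free.scale_right_distrib)

end

section \<open>The coproduct\<close>

text \<open>Freeness enters only through two consequences, assumed here: H is generated by
  \<open>one\<close> and \<open>X\<close>, and there is a morphism \<Delta> for which the elements
  of \<open>X\<close> are primitive.\<close>

locale ns_coproduct = augmented_ns scale one \<kappa> prec succ bul mul
  for scale :: "'k::field \<Rightarrow> 'h::ab_group_add \<Rightarrow> 'h" and one \<kappa> prec succ bul mul +
  fixes X :: "'h set" and \<Delta> :: "'h \<Rightarrow> ('h \<times> 'h \<Rightarrow>\<^sub>0 'k)"
  assumes \<kappa>_generator: "g \<in> X \<Longrightarrow> \<kappa> g = 0"
    and generated: "\<lbrakk>subspace W; one \<in> W; X \<subseteq> W;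
      \<And>x y. x \<in> W \<Longrightarrow> y \<in> W \<Longrightarrow> prec x y \<in> W \<and> succ x y \<in> W \<and> bul x y \<in> W\<rbrakk> \<Longrightarrow> W = UNIV"
    and \<Delta>_add [simp]: "\<Delta> (x + y) = \<Delta> x + \<Delta> y"
    and \<Delta>_scale [simp]: "\<Delta> (scale c x) = fscale c (\<Delta> x)"
    and \<Delta>_one [simp]: "\<Delta> one = tens one one"
    and \<Delta>_op [simp]: "\<Delta> (prec x y) = tprod prec (\<Delta> x) (\<Delta> y)"
      "\<Delta> (succ x y) = tprod succ (\<Delta> x) (\<Delta> y)" "\<Delta> (bul x y) = tprod bul (\<Delta> x) (\<Delta> y)"
    and \<Delta>_generator: "g \<in> X \<Longrightarrow> \<Delta> g = tens g one + tens one g"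
begin

lemma generator_induct [case_names one generator add scale op]:
  assumes "P one" "\<And>g. g \<in> X \<Longrightarrow> P g" "\<And>x y. P x \<Longrightarrow> P y \<Longrightarrow> P (x + y)" "\<And>c x. P x \<Longrightarrow> P (scale c x)"
    "\<And>x y. P x \<Longrightarrow> P y \<Longrightarrow> P (prec x y) \<and> P (succ x y) \<and> P (bul x y)"
  shows "P x"
proof -
  have "P 0" using assms(4)[OF assms(1), of 0] by simp
  then have "{x. P x} = UNIV"
    using assms by (intro generated subspaceI) auto
  then show ?thesis by auto
qed

text \<open>Since \<kappa> vanishes on the values of the three operations, \<open>counitl\<close>
  kills the correction term of \<open>tprod\<close> and \<open>counitr\<close> kills the main term,
  so that there the correction term carries the result.\<close>

lemma counit_tprod:
  "counitl (tprod prec u v) = prec (counitl u) (counitl v)"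
  "counitl (tprod succ u v) = succ (counitl u) (counitl v)"
  "counitl (tprod bul u v) = bul (counitl u) (counitl v)"
  "counitr (tprod prec u v) = prec (counitr u) (counitr v)"
  "counitr (tprod succ u v) = succ (counitr u) (counitr v)"
  "counitr (tprod bul u v) = bul (counitr u) (counitr v)"
  by (induction u v rule: free_induct2; simp add: scale_right_distrib mult_ac)+

lemma counit_\<Delta> [simp]: "counitl (\<Delta> x) = x" "counitr (\<Delta> x) = x"
  by (induction x rule: generator_induct; simp add: counit_tprod \<Delta>_generator \<kappa>_generator)+

lemma tcounit_\<Delta> [simp]: "tcounit (\<Delta> x) = \<kappa> x"
proof -
  have "\<kappa> (counitl u) = tcounit u" for u
  proof (induction u rule: free_induct)
    case (pure x)
    then show ?case by (cases x) simp
  qed simp_all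
  then show ?thesis using counit_\<Delta>(1)[of x] by metis
qed

text \<open>The unit summands of \<open>mul_eq\<close> and \<open>tmul_eq\<close> correspond because
  \<open>tcounit (\<Delta> x)\<close> is \<open>\<kappa> x\<close>.\<close>

lemma \<Delta>_mul [simp]: "\<Delta> (mul x y) = tmul (\<Delta> x) (\<Delta> y)"
  by (simp add: mul_eq tmul_eq)

text \<open>\<Delta> \<otimes> id and its mirror image \<open>coassr\<close> with values in normal
  form, so that coassociativity becomes an equation that can be checked on generators.\<close>

definition coassl :: "('h \<times> 'h \<Rightarrow>\<^sub>0 'k) \<Rightarrow> ('h \<times> 'h \<times> 'h \<Rightarrow>\<^sub>0 'k)"
  where "coassl = lin_ext fscale (\<lambda>(x, y). tens3r y (\<Delta> x))"

definition coassr :: "('h \<times> 'h \<Rightarrow>\<^sub>0 'k) \<Rightarrow> ('h \<times> 'h \<times> 'h \<Rightarrow>\<^sub>0 'k)"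
  where "coassr = lin_ext fscale (\<lambda>(x, y). tens3l x (\<Delta> y))"

lemma coass_nf2 [simp]: "coassl (nf2 u) = coassl u" "coassr (nf2 u) = coassr u"
  unfolding coassl_def coassr_def by (rule tensor2_rel_lift[OF vector_space_fscale]; simp)+

lemma coass_simps [simp]:
  "coassl (u + v) = coassl u + coassl v" "coassl (fscale c u) = fscale c (coassl u)"
  "coassl (pure (a, b)) = tens3r b (\<Delta> a)" "coassl (tens a b) = tens3r b (\<Delta> a)"
  "coassr (u + v) = coassr u + coassr v" "coassr (fscale c u) = fscale c (coassr u)"
  "coassr (pure (a, b)) = tens3l a (\<Delta> b)" "coassr (tens a b) = tens3l a (\<Delta> b)"
  by (simp_all add: tens_def) (simp_all add: coassl_def coassr_def)

lemma coass_eq: "coassl u = nf3 (comult_left \<Delta> u)" "coassr u = nf3 (comult_right \<Delta> u)"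
proof -
  have l: "nf3 (lin_ext fscale (\<lambda>(a, b). pure (a, b, z)) u) = tens3r z u"
    and r: "nf3 (lin_ext fscale (\<lambda>(a, b). pure (z, a, b)) u) = tens3l z u" for z u
    by (induction u rule: free_induct; force simp: tens3_def nf3.add nf3.scale)+
  show "coassl u = nf3 (comult_left \<Delta> u)"
    by (induction u rule: free_induct) (auto simp: comult_left_def l nf3.add nf3.scale)
  show "coassr u = nf3 (comult_right \<Delta> u)"
    by (induction u rule: free_induct) (auto simp: comult_right_def r nf3.add nf3.scale)
qed

text \<open>By \<open>tprod3_tens3r\<close> and \<open>tprod3_tens3l\<close>, \<Delta> \<otimes> id
  and id \<otimes> \<Delta> are morphisms into the same threefold operation. Hence the two iterated
  coproducts agree once they agree on generators.\<close>

lemma coass_tprod: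
  assumes m: "bilinear_op_on scale UNIV m"
    and \<Delta>m: "\<And>x y. \<Delta> (m x y) = tprod m (\<Delta> x) (\<Delta> y)"
  shows "coassl (tprod m u v) = tprod3 m (coassl u) (coassl v)"
    and "coassr (tprod m u v) = tprod3 m (coassr u) (coassr v)"
  by (induction u v rule: free_induct2;
      simp add: tprod_simps[OF m] tprod3_simps[OF m] tprod3_tens3l[OF m] tprod3_tens3r[OF m] \<Delta>m)+

lemma coass_\<Delta>: "coassl (\<Delta> x) = coassr (\<Delta> x)"
  by (induction x rule: generator_induct)
    (simp_all add: \<Delta>_generator coass_tprod bil_prec bil_succ bil_bul ac_simps)

lemma bialgebra: "bialgebra scale mul one \<Delta> \<kappa>"
proof (rule bialgebra.intro[OF vector_space_axioms bialgebra_axioms.intro])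
  show "bilinear_op_on scale UNIV mul" by (rule bil_mul)
  show "Vector_Spaces.linear scale (*) \<kappa>" by (rule linear_\<kappa>)
  show "lin_ext scale (\<lambda>(y, z). scale (\<kappa> y) z) (\<Delta> x) = x"
    "lin_ext scale (\<lambda>(y, z). scale (\<kappa> z) y) (\<Delta> x) = x" for x
    using counit_\<Delta>[of x] by (simp_all add: counitl_def counitr_def)
  show "tensor3_eq scale (comult_left \<Delta> (\<Delta> x)) (comult_right \<Delta> (\<Delta> x))" for x
    using coass_\<Delta>[of x] by (simp add: tensor3_eq_iff coass_eq)
  show "tensor2_eq scale (\<Delta> (mul x y)) (tensor2_mult mul (\<Delta> x) (\<Delta> y))" for x y
    by (simp add: tensor2_eq_iff tmul_nf2)
  show "tensor2_eq scale (\<Delta> one) (pure (one, one))"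
    by (simp add: tensor2_eq_iff tens_def)
qed (simp_all add: mul_assoc tensor2_eq_iff)

section \<open>Connectedness and the antipode\<close>

text \<open>An upper bound for the number of generators in the monomials of an element. Bounds
  rather than exact degrees are used, so \<open>one\<close> occurs at every level and a generator at
  every positive level.\<close>

inductive degree_le :: "nat \<Rightarrow> 'h \<Rightarrow> bool" where
  one: "degree_le n one"
| generator: "g \<in> X \<Longrightarrow> degree_le (Suc n) g"
| add: "degree_le n x \<Longrightarrow> degree_le n y \<Longrightarrow> degree_le n (x + y)"
| scale: "degree_le n x \<Longrightarrow> degree_le n (scale c x)"
| prec: "degree_le i x \<Longrightarrow> degree_le j y \<Longrightarrow> degree_le (i + j) (prec x y)"
| succ: "degree_le i x \<Longrightarrow> degree_le j y \<Longrightarrow> degree_le (i + j) (succ x y)"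
| bul: "degree_le i x \<Longrightarrow> degree_le j y \<Longrightarrow> degree_le (i + j) (bul x y)"

lemma degree_le_Suc: "degree_le n x \<Longrightarrow> degree_le (Suc n) x"
  by (induction rule: degree_le.induct) (auto intro: degree_le.intros simp flip: add_Suc)

lemma degree_le_mono: "i \<le> j \<Longrightarrow> degree_le i x \<Longrightarrow> degree_le j x"
  by (induction rule: dec_induct) (auto intro: degree_le_Suc)

text \<open>All three operations vanish on two multiples of \<open>one\<close>, and generators have
  positive degree.\<close>

lemma degree_le_0: "degree_le n x \<Longrightarrow> n = 0 \<Longrightarrow> x \<in> range (\<lambda>c. scale c one)"
proof (induction rule: degree_le.induct)
  case (one n)
  then show ?case by (metis rangeI scale_one)
next
  case (add n x y)
  then show ?case by (auto simp flip: scale_left_distrib)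
next
  case (prec i x j y)
  then show ?case by (auto intro: range_eqI[of _ _ 0])
next
  case (succ i x j y)
  then show ?case by (auto intro: range_eqI[of _ _ 0])
next
  case (bul i x j y)
  then show ?case by (auto intro: range_eqI[of _ _ 0])
qed auto

lemma degree_le_zero [simp]: "degree_le n 0"
  using degree_le.scale[OF degree_le.one, of n 0] by simp

lemma degree_le_mul: "degree_le i x \<Longrightarrow> degree_le j y \<Longrightarrow> degree_le (i + j) (mul x y)"
  unfolding mul_eq by (intro degree_le.intros)

lemma degree_exists: "\<exists>n. degree_le n x"
proof (induction x rule: generator_induct)
  case (add x y)
  then obtain i j where "degree_le i x" "degree_le j y" by blast
  then have "degree_le (max i j) (x + y)"
    by (intro degree_le.add) (auto intro: degree_le_mono[of i "max i j"] degree_le_mono[of j "max i j"])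
  then show ?case by blast
qed (blast intro: degree_le.intros)+

definition degree2_le :: "nat \<Rightarrow> ('h \<times> 'h \<Rightarrow>\<^sub>0 'k) set"
  where "degree2_le n = free.span {tens a b |a b i j. degree_le i a \<and> degree_le j b \<and> i + j = n}"

lemma degree2_le_tens: "degree_le i a \<Longrightarrow> degree_le j b \<Longrightarrow> i + j = n \<Longrightarrow> tens a b \<in> degree2_le n"
  unfolding degree2_le_def by (rule free.span_base) blast

lemma degree2_le_tprod:
  assumes m: "bilinear_op_on scale UNIV m"
    and deg: "\<And>i j x y. degree_le i x \<Longrightarrow> degree_le j y \<Longrightarrow> degree_le (i + j) (m x y)"
    and u: "u \<in> degree2_le n" and v: "v \<in> degree2_le n'"
  shows "tprod m u v \<in> degree2_le (n + n')"
proof -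
  note S = tprod_simps[OF m]
  note cl = free.span_zero free.span_add free.span_scale
  have 1: "tprod m (tens a b) v \<in> degree2_le (n + n')"
    if ab: "degree_le i a" "degree_le j b" "i + j = n" for a b i j
    using v unfolding degree2_le_def[of n']
  proof (induction rule: free.span_induct_alt)
    case base
    show ?case by (simp add: S degree2_le_def cl)
  next
    case (step c x y)
    then obtain a' b' i' j' where x: "x = tens a' b'" "degree_le i' a'" "degree_le j' b'" "i' + j' = n'"
      by blast
    have "tens (mul a a') (m b b') \<in> degree2_le (n + n')"
      using ab x(2-) by (intro degree2_le_tens[OF degree_le_mul deg]) auto
    \<comment> \<open>The unit is assigned the degree \<open>j + j'\<close>, so that the total is
      exactly \<open>n + n'\<close>.\<close>
    moreover have "tens (m a a') one \<in> degree2_le (n + n')"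
      using ab x(2-)
      by (intro degree2_le_tens[OF deg degree_le.one[of "j + j'"]]) auto
    ultimately show ?case
      using step(2) unfolding x(1) S degree2_le_def
      by (intro cl)
  qed
  show ?thesis
    using u unfolding degree2_le_def[of n]
  proof (induction rule: free.span_induct_alt)
    case base
    show ?case by (simp add: S degree2_le_def cl)
  next
    case (step c x y)
    then obtain a b i j where "x = tens a b" "degree_le i a" "degree_le j b" "i + j = n" by blast
    with 1[of i a j b] have "tprod m x v \<in> degree2_le (n + n')" by simp
    then show ?case
      using step(2) unfolding S(1) S(3) degree2_le_def by (intro cl)
  qed
qed

lemma \<Delta>_degree: "degree_le n x \<Longrightarrow> \<Delta> x \<in> degree2_le n"
proof (induction rule: degree_le.induct)
  case (one n)
  show ?case unfolding \<Delta>_one by (rule degree2_le_tens[OF degree_le.one[of 0] degree_le.one[of n]]) simp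
next
  case (generator g n)
  then have "tens g one \<in> degree2_le (Suc n)" "tens one g \<in> degree2_le (Suc n)"
    using degree2_le_tens[OF degree_le.generator[of g n] degree_le.one[of 0]]
      degree2_le_tens[OF degree_le.one[of 0] degree_le.generator[of g n]] by auto
  then show ?case
    unfolding \<Delta>_generator[OF generator] degree2_le_def by (rule free.span_add)
next
  case (prec i x j y)
  then show ?case using degree2_le_tprod[OF bil_prec degree_le.prec] by simp
next
  case (succ i x j y)
  then show ?case using degree2_le_tprod[OF bil_succ degree_le.succ] by simp
next
  case (bul i x j y)
  then show ?case using degree2_le_tprod[OF bil_bul degree_le.bul] by simp
qed (simp_all add: degree2_le_def free.span_add free.span_scale)

definition square :: "nat \<Rightarrow> ('h \<times> 'h \<Rightarrow>\<^sub>0 'k) set"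
  where "square n = free.span {tens a b |a b. degree_le n a \<and> degree_le n b}"

lemma square_tens: "degree_le n a \<Longrightarrow> degree_le n b \<Longrightarrow> tens a b \<in> square n"
  unfolding square_def by (rule free.span_base) blast

lemma square_add: "u \<in> square n \<Longrightarrow> v \<in> square n \<Longrightarrow> u + v \<in> square n"
  unfolding square_def by (rule free.span_add)

text \<open>If i + j = n + 1, then i = 0, or j = 0, or both are at most n; a factor of degree 0 is a
  multiple of \<open>one\<close>.\<close>

lemma degree2_le_split:
  assumes "u \<in> degree2_le (Suc n)"
  shows "\<exists>x y r. degree_le (Suc n) x \<and> degree_le (Suc n) y \<and> r \<in> square n \<and>
    u = tens x one + tens one y + r"
  using assms unfolding degree2_le_def
proof (induction rule: free.span_induct_alt)
  case base
  have "(0 :: 'h \<times> 'h \<Rightarrow>\<^sub>0 'k) \<in> square n" unfolding square_def by (rule free.span_zero)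
  then show ?case by (intro exI[of _ 0]) simp
next
  case (step c w v)
  have "\<exists>x y r. degree_le (Suc n) x \<and> degree_le (Suc n) y \<and> r \<in> square n \<and>
      fscale c w = tens x one + tens one y + r"
  proof -
    obtain a b i j where w: "w = tens a b" "degree_le i a" "degree_le j b" "i + j = Suc n"
      using step(1) by blast
    have z: "(0 :: 'h \<times> 'h \<Rightarrow>\<^sub>0 'k) \<in> square n" unfolding square_def by (rule free.span_zero)
    consider "i = 0" | "j = 0" | "i \<le> n" "j \<le> n" using w(4) by linarith
    then show ?thesis
    proof cases
      case 1
      then obtain d where d: "a = scale d one" using degree_le_0[OF w(2)] by blast
      have "degree_le (Suc n) (scale (c * d) b)" using w 1 by (auto intro: degree_le.scale)
      then show ?thesis
        using z by (intro exI[of _ 0] exI[of _ "scale (c * d) b"] exI[of _ "0 :: 'h \<times> 'h \<Rightarrow>\<^sub>0 'k"])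
          (auto simp: w(1) d)
    next
      case 2
      then obtain d where d: "b = scale d one" using degree_le_0[OF w(3)] by blast
      have "degree_le (Suc n) (scale (c * d) a)" using w 2 by (auto intro: degree_le.scale)
      then show ?thesis
        using z by (intro exI[of _ "scale (c * d) a"] exI[of _ 0] exI[of _ "0 :: 'h \<times> 'h \<Rightarrow>\<^sub>0 'k"])
          (auto simp: w(1) d)
    next
      case 3
      have "tens (scale c a) b \<in> square n"
        using w(2,3) 3 by (intro square_tens degree_le.scale) (auto intro: degree_le_mono)
      then show ?thesis by (intro exI[of _ 0] exI[of _ "tens (scale c a) b"]) (auto simp: w(1))
    qed
  qed
  then obtain x y r where 1: "degree_le (Suc n) x" "degree_le (Suc n) y" "r \<in> square n"
    "fscale c w = tens x one + tens one y + r" by blast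
  obtain x' y' r' where 2: "degree_le (Suc n) x'" "degree_le (Suc n) y'" "r' \<in> square n"
    "v = tens x' one + tens one y' + r'" using step(2) by blast
  show ?case
    using 1 2 by (intro exI[of _ "x + x'"] exI[of _ "y + y'"] exI[of _ "r + r'"])
      (auto intro: degree_le.add square_add simp: algebra_simps)
qed

lemma counit_square: "r \<in> square n \<Longrightarrow> degree_le n (counitl r) \<and> degree_le n (counitr r)"
  unfolding square_def
proof (induction rule: free.span_induct_alt)
  case base
  show ?case using tens_linear_simps(5)[of 0 0] tens_linear_simps(8)[of 0 0] by simp
qed (auto intro!: degree_le.add degree_le.scale simp flip: scale_scale)

text \<open>The outer parts \<open>x'\<close>, \<open>y'\<close> of \<open>\<Delta> x\<close> are recovered from \<open>x\<close> by applying the counits,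
  up to terms of lower degree.\<close>

lemma reduced_\<Delta>_square:
  assumes "degree_le (Suc n) x"
  shows "\<Delta> x - tens one x - tens x one \<in> square n"
proof -
  obtain x' y' r where r: "r \<in> square n" and e: "\<Delta> x = tens x' one + tens one y' + r"
    using degree2_le_split[OF \<Delta>_degree[OF assms]] by blast
  have l: "x = scale (\<kappa> x') one + y' + counitl r" and r': "x = x' + scale (\<kappa> y') one + counitr r"
    using counit_\<Delta>[of x] unfolding e by simp_all
  \<comment> \<open>By the two equations above, \<open>g\<close> is x - y' and \<open>h\<close> is x
    - x'; both have degree at most n although x is only bounded by n + 1.\<close>
  define g where "g = scale (\<kappa> x') one + counitl r"
  define h where "h = scale (\<kappa> y') one + counitr r"
  have x': "x' = x - h" and y': "y' = x - g"
    using l r' unfolding g_def h_def by (simp_all add: algebra_simps)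
  have deg: "degree_le n g" "degree_le n h"
    unfolding g_def h_def using counit_square[OF r] by (auto intro: degree_le.intros)
  have "\<Delta> x - tens one x - tens x one = r + tens (scale (-1) h) one + tens one (scale (-1) g)"
    unfolding e x' y' by simp
  moreover have "\<dots> \<in> square n"
    using deg r by (intro square_add square_tens degree_le.intros)
  ultimately show ?thesis by simp
qed

lemma degree_le_conn_filtration: "degree_le n x \<Longrightarrow> x \<in> conn_filtration scale one \<Delta> n"
proof (induction n arbitrary: x)
  case 0
  show ?case unfolding conn_filtration.simps by (rule degree_le_0[OF 0 refl])
next
  case (Suc n)
  let ?P = "{pure (a, b) |a b. a \<in> conn_filtration scale one \<Delta> n \<and> b \<in> conn_filtration scale one \<Delta> n}
    :: ('h \<times> 'h \<Rightarrow>\<^sub>0 'k) set"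
  \<comment> \<open>The filtration asks for a representative in the span of elements
    \<open>pure (a, b)\<close>. Normal forms commute with spans, so the reduced coproduct has
    one.\<close>
  have "square n \<subseteq> free.span (nf2 ` ?P)"
    unfolding square_def
  proof (rule free.span_mono, rule subsetI)
    fix w assume "w \<in> {tens a b |a b. degree_le n a \<and> degree_le n b}"
    then obtain a b where w: "w = nf2 (pure (a, b))" "degree_le n a" "degree_le n b"
      unfolding tens_def by blast
    have "pure (a, b) \<in> ?P" using Suc.IH[OF w(2)] Suc.IH[OF w(3)] by blast
    then show "w \<in> nf2 ` ?P" unfolding w(1) by (rule imageI)
  qed
  also have "\<dots> = nf2 ` free.span ?P" by (rule nf2.span_image)
  finally have "\<Delta> x - tens one x - tens x one \<in> nf2 ` free.span ?P"
    using reduced_\<Delta>_square[OF Suc.prems] by (rule subsetD)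
  then obtain u where u: "\<Delta> x - tens one x - tens x one = nf2 u" "u \<in> free.span ?P"
    by (rule imageE)
  have "nf2 (\<Delta> x - tens one x - tens x one) = nf2 u" unfolding u(1) by simp
  then have "tensor2_eq scale (\<Delta> x - pure (one, x) - pure (x, one)) u"
    by (simp only: tensor2_eq_iff nf2.diff nf2_tens) (simp only: tens_def)
  then show ?case
    unfolding conn_filtration.simps mem_Collect_eq using u(2) by (rule bexI)
qed

lemma connected: "(\<Union>n. conn_filtration scale one \<Delta> n) = UNIV"
proof (rule sym, rule UNIV_eq_I)
  fix x
  obtain n where "degree_le n x" using degree_exists by blast
  then show "x \<in> (\<Union>n. conn_filtration scale one \<Delta> n)"
    by (intro UN_I[OF UNIV_I] degree_le_conn_filtration)
qed

section \<open>Convolution of linear endomorphisms\<close>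

definition lin :: "('h \<Rightarrow> 'h) \<Rightarrow> bool"
  where "lin f \<longleftrightarrow> (\<forall>x y. f (x + y) = f x + f y) \<and> (\<forall>c x. f (scale c x) = scale c (f x))"

lemma linI: "(\<And>x y. f (x + y) = f x + f y) \<Longrightarrow> (\<And>c x. f (scale c x) = scale c (f x)) \<Longrightarrow> lin f"
  unfolding lin_def by blast

lemma linD: "lin f \<Longrightarrow> f (x + y) = f x + f y" "lin f \<Longrightarrow> f (scale c x) = scale c (f x)"
  unfolding lin_def by blast+

text \<open>The composite of f \<otimes> g with the product; applied to \<Delta> it gives the
  convolution product \<open>conv\<close>.\<close>

definition mulmap :: "('h \<Rightarrow> 'h) \<Rightarrow> ('h \<Rightarrow> 'h) \<Rightarrow> ('h \<times> 'h \<Rightarrow>\<^sub>0 'k) \<Rightarrow> 'h"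
  where "mulmap f g = lin_ext scale (\<lambda>(y, z). mul (f y) (g z))"

definition conv :: "('h \<Rightarrow> 'h) \<Rightarrow> ('h \<Rightarrow> 'h) \<Rightarrow> 'h \<Rightarrow> 'h"
  where "conv f g x = mulmap f g (\<Delta> x)"

lemma mulmap_simps [simp]:
  "mulmap f g (u + v) = mulmap f g u + mulmap f g v"
  "mulmap f g (fscale c u) = scale c (mulmap f g u)"
  "mulmap f g (pure (a, b)) = mul (f a) (g b)"
  by (simp_all add: mulmap_def)

lemma mulmap_nf2: "lin f \<Longrightarrow> lin g \<Longrightarrow> mulmap f g (nf2 u) = mulmap f g u"
  unfolding mulmap_def by (rule tensor2_rel_lift[OF vector_space_axioms]) (auto simp: linD)

lemma mulmap_tens: "lin f \<Longrightarrow> lin g \<Longrightarrow> mulmap f g (tens a b) = mul (f a) (g b)"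
  unfolding tens_def by (simp add: mulmap_nf2)

lemma lin_conv: "lin (conv f g)"
  by (rule linI) (simp_all add: conv_def)

text \<open>Both sides apply the trilinear map (a, b, c) \<mapsto> f(a) g(b) h(c) to an iterated
  coproduct, and the two iterated coproducts agree by coassociativity.\<close>

lemma conv_assoc:
  assumes f: "lin f" and g: "lin g" and h: "lin h"
  shows "conv (conv f g) h = conv f (conv g h)"
proof
  fix x
  define M where "M = lin_ext scale (\<lambda>(a, b, c). mul (f a) (mul (g b) (h c)))"
  have M_nf3: "M (nf3 u) = M u" for u
    unfolding M_def by (rule tensor3_rel_lift[OF vector_space_axioms]) (auto simp: linD f g h)
  have M_simps: "M (u + v) = M u + M v" "M (fscale c u) = scale c (M u)"
    "M (pure (a, b, d)) = mul (f a) (mul (g b) (h d))" for u v c a b d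
    by (simp_all add: M_def)
  have M_tens3: "M (tens3 a b c) = mul (f a) (mul (g b) (h c))" for a b c
    unfolding tens3_def by (simp add: M_nf3 M_simps)
  have r: "M (tens3r z u) = mul (mulmap f g u) (h z)" and l: "M (tens3l z u) = mul (f z) (mulmap g h u)" for z u
    by (induction u rule: free_induct; force simp: M_simps M_tens3 mul_assoc)+
  have "M (coassl u) = mulmap (conv f g) h u" "M (coassr u) = mulmap f (conv g h) u" for u
    by (induction u rule: free_induct; force simp: M_simps r l conv_def)+
  then show "conv (conv f g) h x = conv f (conv g h) x"
    unfolding conv_def by (metis coass_\<Delta>)
qed

text \<open>The antipode is the sum of the convolution powers of \<open>J = \<eta>\<kappa> - id\<close>.\<close>

definition J :: "'h \<Rightarrow> 'h"
  where "J x = scale (\<kappa> x) one - x"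

primrec J_power :: "nat \<Rightarrow> 'h \<Rightarrow> 'h" where
  "J_power 0 = (\<lambda>x. scale (\<kappa> x) one)"
| "J_power (Suc n) = conv J (J_power n)"

lemma lin_J: "lin J"
  by (rule linI) (simp_all add: J_def scale_left_distrib scale_right_diff_distrib)

lemma lin_J_power: "lin (J_power n)"
  by (cases n) (simp_all add: lin_conv, rule linI, simp_all add: scale_left_distrib)

lemma conv_unit: "lin f \<Longrightarrow> conv (\<lambda>x. scale (\<kappa> x) one) f = f" "lin f \<Longrightarrow> conv f (\<lambda>x. scale (\<kappa> x) one) = f"
proof -
  assume f: "lin f"
  have "mulmap (\<lambda>x. scale (\<kappa> x) one) f u = f (counitl u)" "mulmap f (\<lambda>x. scale (\<kappa> x) one) u = f (counitr u)" for u
    by (induction u rule: free_induct; force simp: linD[OF f])+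
  then show "conv (\<lambda>x. scale (\<kappa> x) one) f = f" "conv f (\<lambda>x. scale (\<kappa> x) one) = f"
    by (simp_all add: conv_def fun_eq_iff)
qed

text \<open>Powers of \<open>J\<close> can be built up from the right as well, which gives the
  second of the two antipode identities.\<close>

lemma J_power_Suc': "J_power (Suc n) = conv (J_power n) J"
  by (induction n) (simp_all add: conv_unit lin_J conv_assoc[OF lin_J lin_J_power lin_J, symmetric])

lemma J_degree_0: "degree_le 0 x \<Longrightarrow> J x = 0"
  using degree_le_0[of 0 x] by (auto simp: J_def)

text \<open>\<open>J\<close> kills multiples of \<open>one\<close>, so in each surviving term of
  \<Delta> x the factor under \<open>J\<close> has a positive degree bound and leaves the other
  factor a smaller one.\<close>

lemma J_power_vanishes: "degree_le i x \<Longrightarrow> i < n \<Longrightarrow> J_power n x = 0"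
proof (induction n arbitrary: i x)
  case (Suc n)
  have "mulmap J (J_power n) (\<Delta> x) = 0"
    using \<Delta>_degree[OF Suc.prems(1)] unfolding degree2_le_def
  proof (induction rule: free.span_induct_alt)
    case base
    show ?case using mulmap_simps(2)[of J "J_power n" 0 0] by simp
  next
    case (step c w v)
    then obtain a b j k where w: "w = tens a b" "degree_le j a" "degree_le k b" "j + k = i" by blast
    have "mul (J a) (J_power n b) = 0"
    proof (cases "j = 0")
      case True
      then show ?thesis using w(2) J_degree_0 by simp
    next
      case False
      then have "J_power n b = 0" using Suc.IH[OF w(3)] w(4) Suc.prems(2) by linarith
      then show ?thesis by simp
    qed
    then show ?case using step(2) by (simp add: w(1) mulmap_tens lin_J lin_J_power)
  qed
  then show ?case by (simp add: conv_def)
qed simp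

text \<open>The geometric series in \<open>J\<close>, truncated at the least degree bound of x; by
  \<open>antip_eq\<close> any other bound gives the same sum.\<close>

definition antip :: "'h \<Rightarrow> 'h"
  where "antip x = (\<Sum>n\<le>(LEAST i. degree_le i x). J_power n x)"

lemma antip_eq:
  assumes "degree_le i x"
  shows "antip x = (\<Sum>n\<le>i. J_power n x)"
proof -
  let ?d = "LEAST i. degree_le i x"
  have d: "degree_le ?d x" "?d \<le> i" using assms by (auto intro: LeastI Least_le)
  show ?thesis
    unfolding antip_def using d(2) by (intro sum.mono_neutral_left) (auto intro: J_power_vanishes[OF d(1)])
qed

lemma lin_antip: "lin antip"
proof (rule linI)
  fix x y
  obtain i j where "degree_le i x" "degree_le j y" using degree_exists by blast
  then have d: "degree_le (max i j) x" "degree_le (max i j) y"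
    by (auto intro: degree_le_mono[of i "max i j"] degree_le_mono[of j "max i j"])
  show "antip (x + y) = antip x + antip y"
    by (simp add: antip_eq[OF d(1)] antip_eq[OF d(2)] antip_eq[OF degree_le.add[OF d]]
        linD[OF lin_J_power] sum.distrib)
next
  fix c x
  obtain i where d: "degree_le i x" using degree_exists by blast
  show "antip (scale c x) = scale c (antip x)"
    by (simp add: antip_eq[OF d] antip_eq[OF degree_le.scale[OF d]] linD[OF lin_J_power] scale_sum_right)
qed

text \<open>Both factors of every tensor in \<open>degree2_le i\<close> have degree at most i, so
  one truncation at i serves for all of them.\<close>

lemma mulmap_antip:
  assumes f: "lin f" and u: "u \<in> degree2_le i"
  shows "mulmap f antip u = (\<Sum>n\<le>i. mulmap f (J_power n) u)"
    "mulmap antip f u = (\<Sum>n\<le>i. mulmap (J_power n) f u)"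
proof -
  have z: "mulmap f g 0 = 0" for f g using mulmap_simps(2)[of f g 0 0] by simp
  have s: "mul x (sum F {..i}) = (\<Sum>n\<le>i. mul x (F n))" "mul (sum F {..i}) x = (\<Sum>n\<le>i. mul (F n) x)" for x F
    by (induction i) simp_all
  have "mulmap f antip u = (\<Sum>n\<le>i. mulmap f (J_power n) u) \<and>
    mulmap antip f u = (\<Sum>n\<le>i. mulmap (J_power n) f u)"
    using u unfolding degree2_le_def
  proof (induction rule: free.span_induct_alt)
    case base
    show ?case by (simp add: z)
  next
    case (step c w v)
    then obtain a b j k where w: "w = tens a b" "degree_le j a" "degree_le k b" "j + k = i" by blast
    have "antip a = (\<Sum>n\<le>i. J_power n a)" "antip b = (\<Sum>n\<le>i. J_power n b)"
      using w(4) by (auto intro!: antip_eq intro: degree_le_mono[OF _ w(2)] degree_le_mono[OF _ w(3)])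
    then show ?case
      using step(2) f by (simp add: w(1) mulmap_tens lin_J_power lin_antip s sum.distrib scale_sum_right)
  qed
  then show "mulmap f antip u = (\<Sum>n\<le>i. mulmap f (J_power n) u)"
    "mulmap antip f u = (\<Sum>n\<le>i. mulmap (J_power n) f u)" by auto
qed

lemma conv_antip:
  "conv (\<lambda>x. x) antip x = scale (\<kappa> x) one" "conv antip (\<lambda>x. x) x = scale (\<kappa> x) one"
proof -
  obtain i where d: "degree_le i x" using degree_exists by blast
  \<comment> \<open>The series for x is truncated at i + 1 instead of i; splitting off the power 0
    leaves the shifted sum.\<close>
  have "(\<Sum>n\<le>i. J_power (Suc n) x) = antip x - scale (\<kappa> x) one"
    using sum.atMost_Suc_shift[of "\<lambda>n. J_power n x" i] antip_eq[OF degree_le_Suc[OF d]] by simp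
  then have J: "conv J antip x = antip x - scale (\<kappa> x) one" "conv antip J x = antip x - scale (\<kappa> x) one"
    using mulmap_antip[OF lin_J \<Delta>_degree[OF d]]
    by (simp_all only: conv_def[symmetric] J_power.simps(2)[symmetric] J_power_Suc'[symmetric])
  \<comment> \<open>Since \<open>J\<close> is \<eta>\<kappa> - id and \<eta>\<kappa> is neutral for
    convolution, the convolution of \<open>J\<close> with \<open>antip\<close> is also
    \<open>antip\<close> minus that of the identity with \<open>antip\<close>. Comparison with the
    previous equations gives the claim.\<close>
  have "mulmap J g u = mulmap (\<lambda>x. scale (\<kappa> x) one) g u - mulmap (\<lambda>x. x) g u \<and>
    mulmap g J u = mulmap g (\<lambda>x. scale (\<kappa> x) one) u - mulmap g (\<lambda>x. x) u" for g u
  proof (induction u rule: free_induct)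
    case (pure x)
    then show ?case by (cases x) (simp add: J_def)
  qed (simp_all add: add_diff_add scale_right_diff_distrib)
  then have "conv J antip x = antip x - conv (\<lambda>x. x) antip x" "conv antip J x = antip x - conv antip (\<lambda>x. x) x"
    using conv_unit[OF lin_antip] unfolding conv_def by metis+
  with J show "conv (\<lambda>x. x) antip x = scale (\<kappa> x) one" "conv antip (\<lambda>x. x) x = scale (\<kappa> x) one"
    by simp_all
qed

lemma connected_hopf_algebra: "connected_hopf_algebra scale mul one \<Delta> \<kappa>"
proof (rule connected_hopf_algebra.intro[OF bialgebra connected_hopf_algebra_axioms.intro])
  show "(\<Union>r. conn_filtration scale one \<Delta> r) = UNIV" by (rule connected)
  have "Vector_Spaces.linear scale scale antip"
    using lin_antip vector_space_axioms
    by (simp add: Vector_Spaces.linear_def module_hom_def module_hom_axioms_def lin_def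
        module_iff_vector_space)
  then show "\<exists>S. Vector_Spaces.linear scale scale S \<and>
      (\<forall>x. lin_ext scale (\<lambda>(y, z). mul (S y) z) (\<Delta> x) = scale (\<kappa> x) one \<and>
           lin_ext scale (\<lambda>(y, z). mul y (S z)) (\<Delta> x) = scale (\<kappa> x) one)"
    using conv_antip by (intro exI[of _ antip]) (simp add: conv_def mulmap_def)
qed

end

section \<open>The augmentation of a free NS-algebra\<close>

text \<open>The formulas come from expanding the operations on a1 + x and b1 + y with the unit
  conventions: of the mixed terms only x \<prec> b1 = bx and a1 \<succ> y = ay survive.\<close>

lemma ns_algebra_aug:
  fixes sN :: "'k::field \<Rightarrow> 'a::ab_group_add \<Rightarrow> 'a"
  assumes "ns_algebra sN UNIV p q b"
  shows "augmented_ns (aug_scale sN) aug_one fst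
    (\<lambda>x y. (0, sN (fst y) (snd x) + p (snd x) (snd y)))
    (\<lambda>x y. (0, sN (fst x) (snd y) + q (snd x) (snd y)))
    (\<lambda>x y. (0, b (snd x) (snd y))) (aug_mult sN (ns_star p q b))"
proof -
  interpret ns_algebra sN UNIV p q b by (rule assms)
  note simps = bilinear_on_UNIV_simps[OF vector_space_axioms bilinear_prec]
    bilinear_on_UNIV_simps[OF vector_space_axioms bilinear_succ]
    bilinear_on_UNIV_simps[OF vector_space_axioms bilinear_bul]
  have ns4': "b (ns_star p q b x y) z = q x (b y z) + b x (ns_star p q b y z) - p (b x y) z" for x y z
    using ns4[of x y z] by (simp add: eq_diff_eq)
  have vs: "vector_space (aug_scale sN)"
    by unfold_locales (auto simp: aug_scale_def prod_eq_iff algebra_simps scale_right_distrib scale_left_distrib)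
  show ?thesis
  proof (rule augmented_ns.intro[OF tensor_space.intro[OF vs] augmented_ns_axioms.intro])
    show "Vector_Spaces.linear (aug_scale sN) (*) fst"
      using vs vector_space_mult by (simp add: Vector_Spaces.linear_iff aug_scale_def)
    show "aug_mult sN (ns_star p q b) x y = (0, sN (fst y) (snd x) + p (snd x) (snd y)) +
        (0, sN (fst x) (snd y) + q (snd x) (snd y)) + (0, b (snd x) (snd y)) +
        aug_scale sN (fst x * fst y) aug_one" for x y
      by (simp add: aug_scale_def aug_mult_def aug_one_def ns_star_def ac_simps)
  qed (auto simp: aug_scale_def aug_mult_def aug_one_def prod_eq_iff bilinear_op_on_def simps
      ns1 ns2 ns3 ns4' scale_right_distrib scale_left_distrib scale_right_diff_distrib mult_ac add_ac)
qed

lemma ns_algebra_if_comm_simps: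
  "ns_algebra_if_comm False s A p q b \<longleftrightarrow> ns_algebra s A p q b"
  "ns_algebra_if_comm True s A p q b \<longleftrightarrow> comm_ns_algebra s A p q b"
  unfolding ns_algebra_if_comm_def comm_ns_algebra_def by auto

text \<open>The subalgebra \<open>E\<close> is itself a target of the universal property. The
  resulting morphism N \<rightarrow> E, followed by the inclusion, is the identity by uniqueness, so
  \<open>E\<close> is everything.\<close>

lemma free_ns_generated:
  fixes sV :: "'k::field \<Rightarrow> 'v::ab_group_add \<Rightarrow> 'v" and \<iota> :: "'v \<Rightarrow> 'a::ab_group_add"
  assumes N: "ns_algebra_if_comm c sN UNIV p q b" and \<iota>: "Vector_Spaces.linear sV sN \<iota>"
    and U: "\<And>(B :: (('v + 'a) list \<Rightarrow>\<^sub>0 'k) set) p' q' b' f.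
      ns_algebra_if_comm c fscale B p' q' b' \<Longrightarrow> Vector_Spaces.linear sV fscale f \<Longrightarrow> range f \<subseteq> B \<Longrightarrow>
      \<exists>!\<phi>. ns_hom_into sN p q b fscale B p' q' b' \<phi> \<and> \<phi> \<circ> \<iota> = f"
    and E: "module.subspace sN E" "range \<iota> \<subseteq> E"
      "\<And>x y. x \<in> E \<Longrightarrow> y \<in> E \<Longrightarrow> p x y \<in> E \<and> q x y \<in> E \<and> b x y \<in> E"
  shows "E = UNIV"
proof -
  interpret vector_space sN using N unfolding ns_algebra_if_comm_iff by blast
  have "ns_algebra_if_comm c sN E p q b"
    using E by (intro ns_algebra_if_comm_restrict[OF N]) auto
  from free_universal_aux[OF N \<iota> U this \<iota> E(2)]
  obtain r where r: "ns_hom_into sN p q b sN E p q b r" "r \<circ> \<iota> = \<iota>" by blast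
  have "ns_hom_into sN p q b sN UNIV p q b r" using r(1) unfolding ns_hom_into_def by auto
  moreover have "ns_hom_into sN p q b sN UNIV p q b id"
    unfolding ns_hom_into_def by (simp add: Vector_Spaces.linear_iff vector_space_axioms)
  ultimately have "r = id"
    using free_universal_aux[OF N \<iota> U N \<iota> subset_UNIV] r(2) by (metis comp_id id_comp)
  then show ?thesis using r(1) unfolding ns_hom_into_def by auto
qed

lemma free_ns_augmentation_hopf:
  fixes sV :: "'k::field \<Rightarrow> 'v::ab_group_add \<Rightarrow> 'v" and \<iota> :: "'v \<Rightarrow> 'a::ab_group_add"
  assumes N: "ns_algebra_if_comm c sN UNIV p q b" and \<iota>: "Vector_Spaces.linear sV sN \<iota>"
    and U: "\<And>(B :: (('v + 'a) list \<Rightarrow>\<^sub>0 'k) set) p' q' b' f.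
      ns_algebra_if_comm c fscale B p' q' b' \<Longrightarrow> Vector_Spaces.linear sV fscale f \<Longrightarrow> range f \<subseteq> B \<Longrightarrow>
      \<exists>!\<phi>. ns_hom_into sN p q b fscale B p' q' b' \<phi> \<and> \<phi> \<circ> \<iota> = f"
  shows "\<exists>\<Delta> \<kappa>. connected_hopf_algebra (aug_scale sN) (aug_mult sN (ns_star p q b)) aug_one \<Delta> \<kappa>"
proof -
  define P where "P x y = (0::'k, sN (fst y) (snd x) + p (snd x) (snd y))" for x y :: "'k \<times> 'a"
  define Q where "Q x y = (0::'k, sN (fst x) (snd y) + q (snd x) (snd y))" for x y :: "'k \<times> 'a"
  define B where "B x y = (0::'k, b (snd x) (snd y))" for x y :: "'k \<times> 'a"
  interpret \<iota>: Vector_Spaces.linear sV sN \<iota> by (rule \<iota>)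
  interpret H: augmented_ns "aug_scale sN" aug_one fst P Q B "aug_mult sN (ns_star p q b)"
    using N ns_algebra_aug[of sN p q b] unfolding ns_algebra_if_comm_def P_def Q_def B_def by blast
  \<comment> \<open>Elements of N sit in k1 \<oplus> N as pairs (0, x); sums and multiples inside a
    pair are turned into those of H before bilinearity of the tensor is applied.\<close>
  have inj: "(0, x + y) = (0, x) + ((0, y) :: 'k \<times> 'a)" "(0, sN a x) = aug_scale sN a (0, x)" for x y a
    by (simp_all add: aug_scale_def)
  define f where "f v = H.tens (0, \<iota> v) aug_one + H.tens aug_one (0, \<iota> v)" for v
  have tens_Pair: "H.tens (0, x + y) z = H.tens (0, x) z + H.tens (0, y) z"
    "H.tens z (0, x + y) = H.tens z (0, x) + H.tens z (0, y)"
    "H.tens (0, sN a x) z = fscale a (H.tens (0, x) z)"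
    "H.tens z (0, sN a x) = fscale a (H.tens z (0, x))" for x y a z
    unfolding inj by (rule H.tens_simps)+
  have f_linear: "Vector_Spaces.linear sV fscale f"
    unfolding Vector_Spaces.linear_iff f_def
    by (simp add: \<iota>.add \<iota>.scale tens_Pair \<iota>.vs1.vector_space_axioms vector_space_fscale free.scale_right_distrib)
  have f_taug: "range f \<subseteq> H.taug"
    by (auto simp: f_def H.taug_def H.nf2.add)
  have taug: "ns_algebra_if_comm c fscale H.taug (H.tprod P) (H.tprod Q) (H.tprod B)"
    using N by (intro H.ns_algebra_taug) (auto simp: ns_algebra_if_comm_iff P_def Q_def B_def)
  obtain \<phi> where \<phi>: "ns_hom_into sN p q b fscale H.taug (H.tprod P) (H.tprod Q) (H.tprod B) \<phi>"
    and \<phi>\<iota>: "\<phi> \<circ> \<iota> = f"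
    using ex1_implies_ex[OF free_universal_aux[OF N \<iota> U taug f_linear f_taug]] by blast
  interpret \<phi>: Vector_Spaces.linear sN fscale \<phi> using \<phi> unfolding ns_hom_into_def by blast
  have \<phi>_taug: "H.nf2 (\<phi> x) = \<phi> x" "H.tcounit (\<phi> x) = 0"
    and \<phi>_op: "\<phi> (p x y) = H.tprod P (\<phi> x) (\<phi> y)" "\<phi> (q x y) = H.tprod Q (\<phi> x) (\<phi> y)"
      "\<phi> (b x y) = H.tprod B (\<phi> x) (\<phi> y)" for x y
    using \<phi> unfolding ns_hom_into_def H.taug_def by auto
  \<comment> \<open>\<phi> is extended from N to k1 \<oplus> N by sending 1 to 1 \<otimes>
    1.\<close>
  define \<Delta> where "\<Delta> x = fscale (fst x) (H.tens aug_one aug_one) + \<phi> (snd x)" for x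
  interpret H: ns_coproduct "aug_scale sN" aug_one fst P Q B "aug_mult sN (ns_star p q b)"
    "range (\<lambda>v. (0, \<iota> v))" \<Delta>
  proof (rule ns_coproduct.intro[OF H.augmented_ns_axioms ns_coproduct_axioms.intro])
    fix W :: "('k \<times> 'a) set"
    assume W: "H.subspace W" "aug_one \<in> W" "range (\<lambda>v. (0, \<iota> v)) \<subseteq> W"
      "\<And>x y. x \<in> W \<Longrightarrow> y \<in> W \<Longrightarrow> P x y \<in> W \<and> Q x y \<in> W \<and> B x y \<in> W"
    \<comment> \<open>Generation of H reduces to generation of N: the part of \<open>W\<close>
      inside N is closed under the operations of N.\<close>
    define E where "E = {x. (0, x) \<in> W}"
    have "E = UNIV"
    proof (rule free_ns_generated[OF N \<iota> U])
      show "\<iota>.vs2.subspace E"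
      proof (rule \<iota>.vs2.subspaceI)
        show "0 \<in> E" using H.subspace_0[OF W(1)] by (simp add: E_def zero_prod_def)
        show "x + y \<in> E" if "x \<in> E" "y \<in> E" for x y
          using H.subspace_add[OF W(1), of "(0, x)" "(0, y)"] that by (simp add: E_def)
        show "sN a x \<in> E" if "x \<in> E" for a x
          using H.subspace_scale[OF W(1), of "(0, x)" a] that by (simp add: E_def aug_scale_def)
      qed
      show "range \<iota> \<subseteq> E" using W(3) unfolding E_def by auto
      show "p x y \<in> E \<and> q x y \<in> E \<and> b x y \<in> E" if "x \<in> E" "y \<in> E" for x y
        using W(4)[of "(0, x)" "(0, y)"] that unfolding E_def by (simp add: P_def Q_def B_def)
    qed
    have "aug_scale sN (fst x) aug_one + (0, snd x) \<in> W" for x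
      using \<open>E = UNIV\<close> W(1,2) unfolding E_def by (intro H.subspace_add H.subspace_scale) auto
    moreover have "aug_scale sN (fst x) aug_one + (0, snd x) = x" for x :: "'k \<times> 'a"
      by (simp add: aug_scale_def aug_one_def)
    ultimately show "W = UNIV" by (metis UNIV_eq_I)
  next
    fix g :: "'k \<times> 'a"
    assume "g \<in> range (\<lambda>v. (0, \<iota> v))"
    then obtain v where v: "g = (0, \<iota> v)" by blast
    have "\<phi> (\<iota> v) = f v" using \<phi>\<iota> by (auto simp: fun_eq_iff)
    then show "fst g = 0" "\<Delta> g = H.tens g aug_one + H.tens aug_one g"
      by (simp_all add: v \<Delta>_def f_def)
  next
    fix x y :: "'k \<times> 'a"
    show "\<Delta> (x + y) = \<Delta> x + \<Delta> y"
      by (simp add: \<Delta>_def \<phi>.add free.scale_left_distrib)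
    \<comment> \<open>Products with the multiples of 1 \<otimes> 1 are evaluated by
      \<open>tprod_one\<close>; since \<phi> has values in the augmentation ideal, its values are
      normal forms and the \<open>tcounit\<close> terms vanish.\<close>
    show "\<Delta> (P x y) = H.tprod P (\<Delta> x) (\<Delta> y)"
      by (simp add: \<Delta>_def P_def[of x y] H.nf2.add H.nf2.scale \<phi>.add \<phi>.scale \<phi>_op \<phi>_taug)
    show "\<Delta> (Q x y) = H.tprod Q (\<Delta> x) (\<Delta> y)"
      by (simp add: \<Delta>_def Q_def[of x y] H.nf2.add H.nf2.scale \<phi>.add \<phi>.scale \<phi>_op \<phi>_taug)
    show "\<Delta> (B x y) = H.tprod B (\<Delta> x) (\<Delta> y)"
      by (simp add: \<Delta>_def B_def[of x y] \<phi>_op)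
  next
    show "\<Delta> (aug_scale sN a x) = fscale a (\<Delta> x)" for a x
      by (simp add: \<Delta>_def aug_scale_def \<phi>.scale free.scale_right_distrib)
    have "snd (aug_one :: 'k \<times> 'a) = 0" by (simp add: aug_one_def)
    then show "\<Delta> aug_one = H.tens aug_one aug_one"
      by (simp add: \<Delta>_def \<phi>.zero)
  qed
  show ?thesis using H.connected_hopf_algebra by blast
qed

theorem corollary8p3:
  fixes sV :: "'k::field_char_0 \<Rightarrow> 'v::ab_group_add \<Rightarrow> 'v"
  assumes "vector_space sV"
  shows "(\<forall>(\<iota> :: 'v \<Rightarrow> 'a::ab_group_add) sN prec succ bul.
            free_ns_algebra sV \<iota> sN prec succ bul \<longrightarrow>
            (\<exists>\<Delta> \<kappa>. connected_hopf_algebra (aug_scale sN)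
                     (aug_mult sN (ns_star prec succ bul)) aug_one \<Delta> \<kappa>)) \<and>
         (\<forall>(\<iota> :: 'v \<Rightarrow> 'b::ab_group_add) sN prec succ bul.
            free_comm_ns_algebra sV \<iota> sN prec succ bul \<longrightarrow>
            (\<exists>\<Delta> \<kappa>. connected_hopf_algebra (aug_scale sN)
                     (aug_mult sN (ns_star prec succ bul)) aug_one \<Delta> \<kappa>))"
proof (intro conjI allI impI)
  fix \<iota> :: "'v \<Rightarrow> 'a" and sN prec succ bul
  assume "free_ns_algebra sV \<iota> sN prec succ bul"
  note F = this[unfolded free_ns_algebra_def]
  show "\<exists>\<Delta> \<kappa>. connected_hopf_algebra (aug_scale sN)
      (aug_mult sN (ns_star prec succ bul)) aug_one \<Delta> \<kappa>"
    by (rule free_ns_augmentation_hopf[where c = False, unfolded ns_algebra_if_comm_simps, OF F[THEN conjunct1]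
          F[THEN conjunct2, THEN conjunct1]])
      (rule F[THEN conjunct2, THEN conjunct2, rule_format], intro conjI)
next
  fix \<iota> :: "'v \<Rightarrow> 'b" and sN prec succ bul
  assume "free_comm_ns_algebra sV \<iota> sN prec succ bul"
  note F = this[unfolded free_comm_ns_algebra_def]
  show "\<exists>\<Delta> \<kappa>. connected_hopf_algebra (aug_scale sN)
      (aug_mult sN (ns_star prec succ bul)) aug_one \<Delta> \<kappa>"
    by (rule free_ns_augmentation_hopf[where c = True, unfolded ns_algebra_if_comm_simps, OF F[THEN conjunct1]
          F[THEN conjunct2, THEN conjunct1]])
      (rule F[THEN conjunct2, THEN conjunct2, rule_format], intro conjI)
qed

end
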